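(* Let $dx(t)/dt=Ax(t)$ with $A\in GL(2,\mathbb{A})$ be an autonomous linear differential equation, with $x(0)\in\mathbb{A}^2$, and let $U\subset\mathbb{A}^2$ be a line (one-dimensional subspace). If the eigenvalues of $A$ are real, it is decidable whether the flow intersects $U$, i.e. whether there is $t\in\mathbb{R}^+$ with $x(t)=\exp(At)x(0)\in U$. If the eigenvalues of $A$ are complex (non-real), the flow intersects $U$ infinitely often.
   Context: $\mathbb{A}$ denotes the field of algebraic numbers.
   Formalization: For non-real eigenvalues, A, x(0) and U are taken over the real algebraic numbers (false otherwise: A=diag(i,2i), x(0)=(1,1), U=span(1,2)); throughout, U means the complex span of an algebraic vector, since x(t) is usually transcendental. *)

theory Defs
  imports
    "HOL-Analysis.Analysis"
    "HOL-Computational_Algebra.Polynomial"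
    "HOL-Library.Nat_Bijection"
begin

section \<open>Partial recursive functions\<close>

datatype recf =
    Zero
  | Succ
  | Proj nat
  | Comp recf "recf list"
  | PrimRec recf recf
  | Mu recf

text \<open>\<open>computes f xs y\<close>: the program \<open>f\<close> halts on the argument tuple \<open>xs\<close> with value \<open>y\<close>.
  The recursion and search variables are the first argument.\<close>

inductive computes :: "recf \<Rightarrow> nat list \<Rightarrow> nat \<Rightarrow> bool" where
  zero: "computes Zero xs 0"
| succ: "computes Succ (x # xs) (Suc x)"
| proj: "i < length xs \<Longrightarrow> computes (Proj i) xs (xs ! i)"
| comp: "list_all2 (\<lambda>g y. computes g xs y) gs ys \<Longrightarrow> computes f ys z \<Longrightarrow>
    computes (Comp f gs) xs z"
| prim_0: "computes f xs y \<Longrightarrow> computes (PrimRec f g) (0 # xs) y"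
| prim_Suc: "computes (PrimRec f g) (n # xs) y \<Longrightarrow> computes g (n # y # xs) z \<Longrightarrow>
    computes (PrimRec f g) (Suc n # xs) z"
| mu: "computes f (n # xs) 0 \<Longrightarrow> (\<forall>m<n. \<exists>y. computes f (m # xs) (Suc y)) \<Longrightarrow>
    computes (Mu f) xs n"

inductive_cases computes_ZeroE: "computes Zero xs y"
inductive_cases computes_SuccE: "computes Succ xs y"
inductive_cases computes_ProjE: "computes (Proj i) xs y"
inductive_cases computes_CompE: "computes (Comp f gs) xs y"
inductive_cases computes_Prim0E: "computes (PrimRec f g) (0 # xs) y"
inductive_cases computes_PrimSucE: "computes (PrimRec f g) (Suc n # xs) y"
inductive_cases computes_MuE: "computes (Mu f) xs y"

lemma computes_functional: "computes f xs y \<Longrightarrow> computes f xs z \<Longrightarrow> y = z"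
proof (induction arbitrary: z rule: computes.induct)
  case (comp xs gs ys f w)
  from comp.prems obtain ys' where ys': "list_all2 (\<lambda>g y. computes g xs y) gs ys'"
    and z: "computes f ys' z"
    by (rule computes_CompE)
  have "ys = ys'"
    using comp.IH(1) ys'
    by (intro nth_equalityI) (auto simp: list_all2_conv_all_nth)
  with z comp.IH(2) show ?case by simp
next
  case (mu f n xs)
  from mu.prems have z: "computes f (z # xs) 0" "\<forall>m<z. \<exists>y. computes f (m # xs) (Suc y)"
    by (auto elim: computes_MuE)
  have "\<not> z < n" using mu.IH(2) z(1) by fastforce
  moreover have "\<not> n < z" using mu.IH(1) z(2) by fastforce
  ultimately show ?case by simp
next
  case (prim_Suc f g n xs y w)
  from prim_Suc.prems obtain y' where y': "computes (PrimRec f g) (n # xs) y'"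
    and z: "computes g (n # y' # xs) z"
    by (rule computes_PrimSucE)
  from prim_Suc.IH(1)[OF y'] prim_Suc.IH(2) z show ?case by simp
next
  case (zero xs)
  then show ?case by (rule computes_ZeroE) simp
next
  case (succ x xs)
  then show ?case by (rule computes_SuccE) simp
next
  case (proj i xs)
  from proj.prems show ?case by (rule computes_ProjE) simp
next
  case (prim_0 f xs y g)
  from prim_0.prems have "computes f xs z" by (rule computes_Prim0E)
  then show ?case by (rule prim_0.IH)
qed

text \<open>Decidability of \<open>P\<close> for inputs promised to lie in \<open>D\<close>, where \<open>code n x\<close> says that \<open>n\<close> is
  one of the codes of \<open>x\<close>.  A single program has to be correct on every code of every input;
  its behaviour on numbers that are not codes of elements of \<open>D\<close> is irrelevant.\<close>

definition decidable_on :: "(nat \<Rightarrow> 'a \<Rightarrow> bool) \<Rightarrow> 'a set \<Rightarrow> ('a \<Rightarrow> bool) \<Rightarrow> bool" where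
  "decidable_on code D P \<longleftrightarrow>
     (\<exists>f. \<forall>n x. code n x \<longrightarrow> x \<in> D \<longrightarrow> computes f [n] (if P x then 1 else 0))"


section \<open>Codes of algebraic numbers\<close>

definition rat_decode :: "nat \<Rightarrow> real" where
  "rat_decode n = (case prod_decode n of (k, d) \<Rightarrow> of_int (int_decode k) / of_nat (Suc d))"

text \<open>A code consists of the coefficients of a nonzero (not necessarily irreducible) integer
  polynomial together with the rational centre and radius of a disc that contains the given number
  and no other complex root of the polynomial.\<close>

definition alg_code :: "nat \<Rightarrow> complex \<Rightarrow> bool" where
  "alg_code n z \<longleftrightarrow> (\<exists>cs a b r.
     n = list_encode [list_encode (map int_encode cs), a, b, r] \<and>
     Poly cs \<noteq> (0 :: int poly) \<and>
     {w. poly (map_poly of_int (Poly cs)) w = 0 \<and>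
         cmod (w - Complex (rat_decode a) (rat_decode b)) < rat_decode r} = {z})"

lemma alg_code_unique: "alg_code n z \<Longrightarrow> alg_code n w \<Longrightarrow> z = w"
  unfolding alg_code_def
  by (auto simp: list_encode_eq inj_map_eq_map[OF inj_int_encode])

lemma rat_decode_surj:
  assumes "q \<in> \<rat>"
  shows "\<exists>n. rat_decode n = q"
proof -
  from assms obtain a b where ab: "b > 0" "q = of_int a / of_int b"
    by (metis Rats_cases')
  have "rat_decode (prod_encode (int_encode a, nat b - 1)) = q"
    using ab by (simp add: rat_decode_def)
  thus ?thesis by blast
qed

lemma Rats_approx: "e > 0 \<Longrightarrow> \<exists>n. \<bar>rat_decode n - x\<bar> < e" for x e :: real
proof -
  assume "e > 0"
  then obtain q where "q \<in> \<rat>" "x < q" "q < x + e"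
    using Rats_dense_in_real[of x "x + e"] by auto
  moreover from this obtain n where "rat_decode n = q" using rat_decode_surj by blast
  ultimately have "\<bar>rat_decode n - x\<bar> < e" by linarith
  thus ?thesis by blast
qed

lemma alg_code_algebraic: "alg_code n z \<Longrightarrow> algebraic z"
proof -
  assume "alg_code n z"
  then obtain cs :: "int list" where cs: "Poly cs \<noteq> 0"
    "poly (map_poly of_int (Poly cs)) z = 0"
    unfolding alg_code_def by blast
  show ?thesis
    by (rule algebraicI[OF _ _ cs(2)]) (use cs(1) in \<open>auto simp: coeff_map_poly poly_eq_iff\<close>)
qed

lemma alg_code_exists:
  assumes "algebraic z"
  shows "\<exists>n. alg_code n z"
proof -
  from assms obtain p :: "int poly" where p: "p \<noteq> 0" "poly (map_poly of_int p) z = 0"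
    by (rule algebraicE')
  define R where "R = {w :: complex. poly (map_poly of_int p) w = 0}"
  have "map_poly of_int p \<noteq> (0 :: complex poly)"
    using p(1) by (auto simp: poly_eq_iff coeff_map_poly)
  hence "finite R" unfolding R_def by (rule poly_roots_finite)
  then obtain d where d: "d > 0" "\<And>w. w \<in> R \<Longrightarrow> w \<noteq> z \<Longrightarrow> d \<le> dist z w"
    using finite_set_avoid[of R z] by blast
  obtain r where "\<bar>rat_decode r - d / 4\<bar> < d / 8"
    using Rats_approx[of "d / 8" "d / 4"] d(1) by auto
  hence r: "rat_decode r > 0" "rat_decode r < d / 2"
    using d(1) by linarith+
  obtain a where a: "\<bar>rat_decode a - Re z\<bar> < rat_decode r / 2"
    using Rats_approx[of "rat_decode r / 2" "Re z"] r by auto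
  obtain b where b: "\<bar>rat_decode b - Im z\<bar> < rat_decode r / 2"
    using Rats_approx[of "rat_decode r / 2" "Im z"] r by auto
  let ?c = "Complex (rat_decode a) (rat_decode b)"
  have near: "cmod (z - ?c) < rat_decode r"
    using cmod_le[of "z - ?c"] a b by (simp add: abs_minus_commute)
  have "w = z" if "w \<in> R" "cmod (w - ?c) < rat_decode r" for w
  proof (rule ccontr)
    assume "w \<noteq> z"
    with d that have "d \<le> dist z w" by blast
    also have "\<dots> \<le> dist z ?c + dist w ?c" by (rule dist_triangle2)
    finally show False using near that r by (simp add: dist_norm)
  qed
  hence "{w. poly (map_poly of_int p) w = 0 \<and> cmod (w - ?c) < rat_decode r} = {z}"
    using near p(2) unfolding R_def by blast
  hence "alg_code (list_encode [list_encode (map int_encode (coeffs p)), a, b, r]) z"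
    unfolding alg_code_def using p(1)
    by (intro exI[of _ "coeffs p"] exI[of _ a] exI[of _ b] exI[of _ r]) (simp only: Poly_coeffs simp_thms)
  thus ?thesis by blast
qed


section \<open>Planar linear flows\<close>

definition algebraics :: "complex set" where
  "algebraics = {z. algebraic z}"

definition GL2 :: "complex set \<Rightarrow> (complex^2^2) set" where
  "GL2 K = {A. invertible A \<and> (\<forall>i j. A $ i $ j \<in> K)}"

definition vectors_over :: "complex set \<Rightarrow> (complex^2) set" where
  "vectors_over K = {v. \<forall>i. v $ i \<in> K}"

text \<open>A line over a subfield \<open>K\<close> is identified with its complex span: a trajectory of the flow
  need not have any points with coordinates in \<open>K\<close>.  When \<open>K\<close> consists of real numbers, the real
  points of such a line are precisely those of the corresponding real line.\<close>

definition lines_over :: "complex set \<Rightarrow> (complex^2) set set" where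
  "lines_over K = {vec.span {u} | u. u \<in> vectors_over K \<and> u \<noteq> 0}"

definition eigenvalue :: "complex^'n^'n \<Rightarrow> complex \<Rightarrow> bool" where
  "eigenvalue A l \<longleftrightarrow> (\<exists>v. v \<noteq> 0 \<and> A *v v = l *s v)"

definition mat_exp :: "complex^'n^'n \<Rightarrow> complex^'n^'n" where
  "mat_exp A = (\<Sum>k. ((**) A ^^ k) (mat 1) /\<^sub>R fact k)"

definition flow :: "complex^'n^'n \<Rightarrow> complex^'n \<Rightarrow> real \<Rightarrow> complex^'n" where
  "flow A x0 t = mat_exp (t *\<^sub>R A) *v x0"

text \<open>An instance \<open>(A, x0, U)\<close> is coded by codes of the entries of \<open>A\<close>, of the coordinates of
  \<open>x0\<close> and of the coordinates of a vector spanning \<open>U\<close>.\<close>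

definition instance_code ::
  "nat \<Rightarrow> (complex^2^2) \<times> (complex^2) \<times> (complex^2) set \<Rightarrow> bool" where
  "instance_code n = (\<lambda>(A, x0, U). \<exists>a b c d p q r s u.
     n = list_encode [a, b, c, d, p, q, r, s] \<and>
     alg_code a (A $ 1 $ 1) \<and> alg_code b (A $ 1 $ 2) \<and>
     alg_code c (A $ 2 $ 1) \<and> alg_code d (A $ 2 $ 2) \<and>
     alg_code p (x0 $ 1) \<and> alg_code q (x0 $ 2) \<and>
     alg_code r (u $ 1) \<and> alg_code s (u $ 2) \<and> u \<noteq> 0 \<and> U = vec.span {u})"

lemma instance_code_exists:
  assumes "A \<in> GL2 algebraics" "x0 \<in> vectors_over algebraics" "U \<in> lines_over algebraics"
  shows "\<exists>n. instance_code n (A, x0, U)"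
proof -
  from assms(3) obtain u where u: "u \<in> vectors_over algebraics" "u \<noteq> 0" "U = vec.span {u}"
    by (auto simp: lines_over_def)
  obtain C where C: "\<And>z. algebraic z \<Longrightarrow> alg_code (C z) z"
    using alg_code_exists by metis
  have "instance_code (list_encode (map C
    [A $ 1 $ 1, A $ 1 $ 2, A $ 2 $ 1, A $ 2 $ 2, x0 $ 1, x0 $ 2, u $ 1, u $ 2])) (A, x0, U)"
    unfolding instance_code_def prod.case
    using assms(1,2) u
    by (intro exI[of _ "C _"] exI[of _ u])
      (auto intro!: C simp: GL2_def vectors_over_def algebraics_def)
  thus ?thesis by blast
qed

lemma matrix_mult_norm_bound:
  "\<exists>K\<ge>0. \<forall>(A :: complex^'n^'n) (B :: complex^'n^'n). norm (A ** B) \<le> norm A * norm B * K"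
proof -
  have "bilinear ((**) :: complex^'n^'n \<Rightarrow> complex^'n^'n \<Rightarrow> _)"
    unfolding bilinear_def
    by (intro conjI allI linearI)
      (simp_all add: vec_eq_iff matrix_matrix_mult_def scaleR_sum_right distrib_left distrib_right
        sum.distrib)
  hence "bounded_bilinear ((**) :: complex^'n^'n \<Rightarrow> complex^'n^'n \<Rightarrow> _)"
    by (simp add: bilinear_conv_bounded_bilinear)
  thus ?thesis by (rule bounded_bilinear.nonneg_bounded)
qed

lemma matrix_power_scaleR:
  "((**) (t *\<^sub>R A) ^^ k) (mat 1) = t ^ k *\<^sub>R ((**) A ^^ k) (mat 1)" for A :: "complex^'n^'n"
  by (induction k) (simp_all add: scalar_matrix_assoc matrix_scalar_ac mult.commute)

lemma summable_mat_exp: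
  "summable (\<lambda>k. ((**) A ^^ k) (mat 1) /\<^sub>R fact k)" for A :: "complex^'n^'n"
proof -
  obtain K where K: "K \<ge> 0" "\<And>(A :: complex^'n^'n) (B :: complex^'n^'n). norm (A ** B) \<le> norm A * norm B * K"
    using matrix_mult_norm_bound by blast
  let ?M = "norm (mat 1 :: complex^'n^'n)"
  have bound: "norm (((**) A ^^ k) (mat 1)) \<le> ?M * (norm A * K) ^ k" for k
  proof (induction k)
    case (Suc k)
    have "norm (((**) A ^^ Suc k) (mat 1)) \<le> norm A * norm (((**) A ^^ k) (mat 1)) * K"
      using K(2)[of A "((**) A ^^ k) (mat 1)"] by simp
    also have "\<dots> \<le> norm A * (?M * (norm A * K) ^ k) * K"
      using Suc K(1) by (intro mult_right_mono mult_left_mono) auto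
    finally show ?case by (simp add: mult_ac)
  qed simp
  have "summable (\<lambda>k. ?M * ((norm A * K) ^ k /\<^sub>R fact k))"
    by (intro summable_mult summable_exp_generic)
  then show ?thesis
    by (rule summable_comparison_test'[where N = 0])
      (use bound in \<open>auto simp: field_simps intro!: divide_right_mono\<close>)
qed

lemma flow_0: "flow A x0 0 = x0" for A :: "complex^'n^'n"
proof -
  have "((**) (0 :: complex^'n^'n) ^^ k) (mat 1) /\<^sub>R fact k = (if k = 0 then mat 1 else 0)" for k
    by (cases k) simp_all
  hence "mat_exp (0 :: complex^'n^'n) = mat 1"
    unfolding mat_exp_def by (simp only: sums_unique[OF sums_single[of 0 "\<lambda>_. mat 1"], symmetric])
  thus ?thesis by (simp add: flow_def)
qed

lemma flow_has_vector_derivative: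
  "(flow A x0 has_vector_derivative A *v flow A x0 t) (at t)" for A :: "complex^'n^'n"
proof -
  let ?P = "\<lambda>k. ((**) A ^^ k) (mat 1)"
  define c where "c i k = (?P k *v x0) $ i / fact k" for i k
  have lin: "bounded_linear (\<lambda>M :: complex^'n^'n. (M *v x0) $ i)" for i
    by (intro linear_conv_bounded_linear[THEN iffD1] linearI)
      (auto simp: matrix_vector_mult_def scaleR_sum_right algebra_simps sum.distrib)
  have sums: "(\<lambda>k. c i k * of_real s ^ k) sums (flow A x0 s $ i)" for i s
  proof -
    have "(\<lambda>k. ((**) (s *\<^sub>R A) ^^ k) (mat 1) /\<^sub>R fact k) sums mat_exp (s *\<^sub>R A)"
      unfolding mat_exp_def by (rule summable_sums[OF summable_mat_exp])
    from bounded_linear.sums[OF lin this, of i]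
    have "(\<lambda>k. (((**) (s *\<^sub>R A) ^^ k) (mat 1) /\<^sub>R fact k *v x0) $ i) sums (flow A x0 s $ i)"
      by (simp only: flow_def)
    moreover have "(((**) (s *\<^sub>R A) ^^ k) (mat 1) /\<^sub>R fact k *v x0) $ i = c i k * of_real s ^ k" for k
    proof -
      have "(((**) (s *\<^sub>R A) ^^ k) (mat 1) /\<^sub>R fact k *v x0) $ i
          = (inverse (fact k) * s ^ k) *\<^sub>R (?P k *v x0) $ i"
        by (simp only: matrix_power_scaleR scaleR_scaleR
            linear_cmul[OF bounded_linear.linear[OF lin]])
      thus ?thesis
        by (simp add: c_def scaleR_conv_of_real[where 'a = complex] field_simps)
    qed
    ultimately show ?thesis by simp
  qed
  have summ: "summable (\<lambda>k. c i k * y ^ k)" for i y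
    by (rule powser_inside[of _ "of_real (norm y + 1)"])
      (use sums[of i "norm y + 1"] in \<open>auto simp: sums_iff\<close>)
  have deriv: "((\<lambda>s. flow A x0 s $ i) has_vector_derivative (A *v flow A x0 t) $ i) (at t)" for i
  proof -
    have "(\<lambda>k. \<Sum>j\<in>UNIV. A $ i $ j * (c j k * of_real t ^ k)) sums
        (\<Sum>j\<in>UNIV. A $ i $ j * flow A x0 t $ j)"
      by (intro sums_sum sums_mult sums)
    moreover have "(\<Sum>j\<in>UNIV. A $ i $ j * (c j k * y ^ k)) = diffs (c i) k * y ^ k" for k y
    proof -
      have "diffs (c i) k = (A *v (?P k *v x0)) $ i / fact k"
        by (simp add: diffs_def c_def matrix_vector_mul_assoc fact_Suc del: of_nat_Suc)
      thus ?thesis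
        by (simp add: matrix_vector_mult_def[of A] c_def sum_divide_distrib sum_distrib_right mult.assoc)
    qed
    ultimately have "(\<Sum>k. diffs (c i) k * of_real t ^ k) = (A *v flow A x0 t) $ i"
      by (simp add: sums_iff matrix_vector_mult_def)
    moreover have "((\<lambda>z. \<Sum>k. c i k * z ^ k) has_field_derivative
        (\<Sum>k. diffs (c i) k * of_real t ^ k)) (at (of_real t))"
      by (rule termdiffs_strong_converges_everywhere[OF summ])
    ultimately have "((\<lambda>s. \<Sum>k. c i k * of_real s ^ k) has_vector_derivative
        (A *v flow A x0 t) $ i) (at t)"
      by (intro has_vector_derivative_real_field) simp
    moreover have "(\<lambda>s. \<Sum>k. c i k * of_real s ^ k) = (\<lambda>s. flow A x0 s $ i)"
      using sums by (simp add: sums_iff)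
    ultimately show ?thesis by simp
  qed
  have "((\<lambda>s. flow A x0 s \<bullet> b) has_derivative (\<lambda>h. (h *\<^sub>R (A *v flow A x0 t)) \<bullet> b)) (at t)"
    if "b \<in> Basis" for b
  proof -
    from that obtain i e where b: "b = axis i e" by (auto simp: Basis_vec_def)
    show ?thesis
      using has_derivative_inner_left[OF deriv[of i, unfolded has_vector_derivative_def], of e]
      by (simp add: b inner_axis)
  qed
  thus ?thesis
    unfolding has_vector_derivative_def
    by (subst has_derivative_componentwise_within) blast
qed

end

theory Submission
  imports Defs "HOL-Computational_Algebra.Fundamental_Theorem_Algebra"
begin

text \<open>Let \<open>g t\<close> be the determinant of \<open>u\<close> and \<open>x t\<close>, where \<open>u\<close> spans the line; then \<open>g\<close> solves
  \<open>g'' = T g' - D g\<close> with \<open>T\<close>, \<open>D\<close> the trace and determinant of \<open>A\<close>.  If the eigenvalues are real,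
  solving \<open>g t = 0\<close> for \<open>t\<close> shows that a positive zero exists iff a condition on signs of polynomials
  in the data and their conjugates holds: with \<open>a = g 0\<close> and \<open>c = 2 g' 0 - T a\<close>, either
  \<open>a = c = 0\<close>, or \<open>c = - k a\<close> with \<open>a \<noteq> 0\<close> and \<open>k\<close> exceeding the distance of the eigenvalues.  No
  transcendence theory is involved.  The signs are decided from rational approximations of the data
  together with a Liouville type bound: a nonzero value \<open>\<gamma>\<close> of such a polynomial cannot be
  too small, because multiplication by a positive integer multiple of \<open>\<gamma>\<close> maps the lattice
  generated by the monomials in the data into itself, and hence \<open>\<gamma>\<close> is a root of an integer
  polynomial whose coefficients are bounded by the pigeonhole principle.  The program searches
  for sufficiently good approximations, each of which can be verified by evaluating a polynomial.
  If the eigenvalues are not real, \<open>g\<close> is an exponential times a sinusoid.\<close>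

section \<open>Recursive functions and arithmetic on codes\<close>

text \<open>Transcendence theory is avoided because only the existence of \<open>t\<close> matters:
  with \<open>s\<close> the distance of the eigenvalues, \<open>exp (s * t)\<close> takes every
  value above 1, so \<open>g t = 0\<close> only asks whether the value forced on the exponential
  lies in that range. The quantity \<open>c\<close> is symmetric in the eigenvalues; they enter the
  criterion only through \<open>T * T - 4 * D\<close>, the square of their distance, and never have
  to be computed. The entries may be complex even if the eigenvalues are real, so
  \<open>c = - k a\<close> is a condition on complex numbers. It is expressed through
  \<open>a * cnj c\<close>, which is why conjugates occur. The obstacle is that no approximation
  alone proves an algebraic number to be zero. The lower bound must therefore be a computable
  function of the code. This works because a code \<open>n\<close> bounds whatever is decoded from
  it, and hence degrees, coefficients and, up to a factor, moduli. The program evaluates polynomials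
  only at Gaussian rationals and needs no arithmetic of algebraic numbers.\<close>

definition recursive :: "nat \<Rightarrow> (nat list \<Rightarrow> nat) \<Rightarrow> bool" where
  "recursive k f \<longleftrightarrow> (\<exists>F. \<forall>xs. length xs = k \<longrightarrow> computes F xs (f xs))"

lemma recursive_cong:
  "recursive k f \<Longrightarrow> (\<And>xs. length xs = k \<Longrightarrow> f xs = g xs) \<Longrightarrow> recursive k g"
  unfolding recursive_def by (metis)

lemma recursive_nth: "i < k \<Longrightarrow> recursive k (\<lambda>xs. xs ! i)"
  unfolding recursive_def by (intro exI[of _ "Proj i"]) (auto intro: computes.proj)

lemma recursive_compose:
  assumes "recursive (length gs) f" "\<forall>g\<in>set gs. recursive k g"
  shows "recursive k (\<lambda>xs. f (map (\<lambda>g. g xs) gs))"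
proof -
  obtain F where F: "\<And>xs. length xs = length gs \<Longrightarrow> computes F xs (f xs)"
    using assms(1) unfolding recursive_def by blast
  obtain G where G: "\<And>g xs. g \<in> set gs \<Longrightarrow> length xs = k \<Longrightarrow> computes (G g) xs (g xs)"
    using assms(2) unfolding recursive_def by metis
  show ?thesis unfolding recursive_def
    by (intro exI[of _ "Comp F (map G gs)"] allI impI computes.comp[OF _ F])
      (auto simp: list_all2_conv_all_nth G)
qed

lemma recursive_compose1:
  assumes "recursive 1 (\<lambda>ys. f (ys ! 0))" "recursive k g"
  shows "recursive k (\<lambda>xs. f (g xs))"
  using recursive_compose[of "[g]" "\<lambda>ys. f (ys ! 0)" k] assms by simp

lemma recursive_compose2:
  assumes "recursive 2 (\<lambda>ys. f (ys ! 0) (ys ! 1))" "recursive k g" "recursive k h"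
  shows "recursive k (\<lambda>xs. f (g xs) (h xs))"
  using recursive_compose[of "[g, h]" "\<lambda>ys. f (ys ! 0) (ys ! 1)" k] assms
  by (simp add: numeral_2_eq_2)

lemma recursive_Suc:
  assumes "recursive k f" shows "recursive k (\<lambda>xs. Suc (f xs))"
proof (rule recursive_compose1[OF _ assms])
  show "recursive 1 (\<lambda>ys. Suc (ys ! 0))"
    unfolding recursive_def by (intro exI[of _ Succ]) (auto simp: length_Suc_conv intro: computes.succ)
qed

lemma recursive_const: "recursive k (\<lambda>_. c)"
proof (induction c)
  case 0
  show ?case unfolding recursive_def by (intro exI[of _ Zero]) (auto intro: computes.zero)
qed (rule recursive_Suc)

lemma recursive_rec_nat:
  assumes g: "recursive k g" and m: "recursive k m"
    and h: "recursive (Suc (Suc k)) (\<lambda>xs. h (xs ! 0) (xs ! 1) (drop 2 xs))"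
  shows "recursive k (\<lambda>xs. rec_nat (g xs) (\<lambda>n y. h n y xs) (m xs))"
proof -
  obtain G where G: "\<And>xs. length xs = k \<Longrightarrow> computes G xs (g xs)"
    using g unfolding recursive_def by blast
  obtain H where H: "\<And>xs. length xs = Suc (Suc k) \<Longrightarrow> computes H xs (h (xs ! 0) (xs ! 1) (drop 2 xs))"
    using h unfolding recursive_def by blast
  have R: "computes (PrimRec G H) (n # xs) (rec_nat (g xs) (\<lambda>n y. h n y xs) n)"
    if "length xs = k" for n xs
  proof (induction n)
    case 0
    show ?case using G[OF that] by (auto intro: computes.prim_0)
  next
    case (Suc n)
    show ?case
      using computes.prim_Suc[OF Suc.IH H[of "n # _ # xs"]] that by simp
  qed
  define f where "f ys = rec_nat (g (tl ys)) (\<lambda>n y. h n y (tl ys)) (hd ys)" for ys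
  \<comment> \<open>\<open>PrimRec\<close> takes its counter from the first argument and hands on
    the rest as parameters; this composition puts \<open>m xs\<close> in front of an unchanged copy
    of \<open>xs\<close>.\<close>
  let ?gs = "m # map (\<lambda>i xs. xs ! i) [0..<k]"
  have "recursive (length ?gs) f"
    unfolding recursive_def using R
    by (intro exI[of _ "PrimRec G H"]) (auto simp: length_Suc_conv f_def)
  moreover have "\<forall>g\<in>set ?gs. recursive k g"
    using m by (auto intro: recursive_nth)
  ultimately have "recursive k (\<lambda>xs. f (map (\<lambda>g. g xs) ?gs))"
    by (rule recursive_compose)
  then show ?thesis
  proof (rule recursive_cong)
    fix xs :: "nat list" assume "length xs = k"
    then have "map ((\<lambda>g. g xs) \<circ> (\<lambda>i xs. xs ! i)) [0..<k] = xs"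
      by (intro nth_equalityI) auto
    then show "f (map (\<lambda>g. g xs) ?gs) = rec_nat (g xs) (\<lambda>n y. h n y xs) (m xs)"
      by (simp add: f_def)
  qed
qed

lemma recursive_add:
  assumes "recursive k f" "recursive k g" shows "recursive k (\<lambda>xs. f xs + g xs)"
proof -
  have "recursive k (\<lambda>xs. rec_nat (f xs) (\<lambda>n y. Suc y) (g xs))"
    using assms by (intro recursive_rec_nat recursive_Suc recursive_nth) auto
  moreover have "rec_nat x (\<lambda>n y. Suc y) z = x + z" for x z by (induction z) auto
  ultimately show ?thesis by simp
qed

text \<open>Primitive recursion whose step returns its counter: the last counter before
  \<open>z\<close> is \<open>z - 1\<close>.\<close>

lemma recursive_pred:
  assumes "recursive k f" shows "recursive k (\<lambda>xs. f xs - 1)"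
proof -
  have "recursive k (\<lambda>xs. rec_nat 0 (\<lambda>n y. n) (f xs))"
    using assms by (intro recursive_rec_nat recursive_const recursive_nth) auto
  moreover have "rec_nat 0 (\<lambda>n y. n) z = z - 1" for z by (induction z) auto
  ultimately show ?thesis by simp
qed

lemma recursive_diff:
  assumes "recursive k f" "recursive k g" shows "recursive k (\<lambda>xs. f xs - g xs)"
proof -
  have "recursive k (\<lambda>xs. rec_nat (f xs) (\<lambda>n y. y - 1) (g xs))"
    using assms by (intro recursive_rec_nat recursive_pred recursive_nth) auto
  moreover have "rec_nat x (\<lambda>n y. y - 1) z = x - z" for x z :: nat by (induction z) auto
  ultimately show ?thesis by simp
qed

lemma recursive_mult:
  assumes "recursive k f" "recursive k g" shows "recursive k (\<lambda>xs. f xs * g xs)"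
proof (rule recursive_compose2[OF _ assms])
  have "recursive 2 (\<lambda>xs. rec_nat 0 (\<lambda>n y. y + xs ! 0) (xs ! 1))"
  proof (intro recursive_rec_nat recursive_const recursive_nth)
    have "recursive (Suc (Suc 2)) (\<lambda>xs. xs ! 1 + xs ! 2)"
      by (intro recursive_add recursive_nth) auto
    then show "recursive (Suc (Suc 2)) (\<lambda>xs. xs ! 1 + drop 2 xs ! 0)"
      by (rule recursive_cong) simp
  qed auto
  moreover have "rec_nat 0 (\<lambda>n y. y + x) z = x * z" for x z :: nat by (induction z) auto
  ultimately show "recursive 2 (\<lambda>xs. xs ! 0 * xs ! 1)" by simp
qed

lemma recursive_triangle:
  assumes "recursive k f" shows "recursive k (\<lambda>xs. triangle (f xs))"
proof -
  have "recursive k (\<lambda>xs. rec_nat 0 (\<lambda>n y. y + Suc n) (f xs))"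
    using assms by (intro recursive_rec_nat recursive_add recursive_Suc recursive_const recursive_nth) auto
  moreover have "rec_nat 0 (\<lambda>n y. y + Suc n) z = triangle z" for z by (induction z) auto
  ultimately show ?thesis by simp
qed

section \<open>Inverting the pairing function\<close>

abbreviation pi1 :: "nat \<Rightarrow> nat" where "pi1 n \<equiv> fst (prod_decode n)"
abbreviation pi2 :: "nat \<Rightarrow> nat" where "pi2 n \<equiv> snd (prod_decode n)"

text \<open>The Cantor enumeration runs along the diagonals of constant sum with increasing first
  component, and from the end of a diagonal it jumps to the start of the next.\<close>

lemma prod_decode_Suc:
  "prod_decode (Suc n) = (if pi2 n = 0 then (0, Suc (pi1 n)) else (Suc (pi1 n), pi2 n - 1))"
proof -
  obtain a b where n: "n = prod_encode (a, b)" by (metis prod.collapse prod_decode_inverse)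
  have "Suc n = prod_encode (if b = 0 then (0, Suc a) else (Suc a, b - 1))"
    by (cases b) (auto simp: n prod_encode_def)
  then show ?thesis by (simp add: n del: prod_encode_def)
qed

text \<open>The recursion for the index \<open>pi1 n + pi2 n\<close> of the diagonal of \<open>n\<close> does not need the
  components of the pair.\<close>

lemma diagonal_rec:
  "rec_nat 0 (\<lambda>n s. s + (1 - (triangle (Suc s) - Suc n))) n = pi1 n + pi2 n"
proof (induction n)
  case 0
  have "prod_decode 0 = (0, 0)" using prod_encode_inverse[of "(0, 0)"] by (simp add: prod_encode_def)
  then show ?case by simp
next
  case (Suc n)
  have "n = triangle (pi1 n + pi2 n) + pi1 n"
    using prod_decode_inverse[of n] by (simp add: prod_encode_def case_prod_beta)
  \<comment> \<open>Truncated subtraction makes the increment 1 exactly if \<open>Suc n\<close> has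
    reached \<open>triangle (Suc s)\<close>, the first number of the next diagonal.\<close>
  then show ?case unfolding nat.rec(2) Suc
    by (cases "pi2 n = 0") (auto simp: prod_decode_Suc)
qed

lemma recursive_pi1: "recursive k f \<Longrightarrow> recursive k (\<lambda>xs. pi1 (f xs))"
  and recursive_pi2: "recursive k f \<Longrightarrow> recursive k (\<lambda>xs. pi2 (f xs))"
proof -
  assume f: "recursive k f"
  let ?s = "\<lambda>n. rec_nat 0 (\<lambda>n s. s + (1 - (triangle (Suc s) - Suc n))) n"
  have s: "recursive k (\<lambda>xs. ?s (f xs))"
    by (intro recursive_rec_nat recursive_const f recursive_add recursive_diff recursive_Suc
        recursive_triangle recursive_nth) auto
  have eq: "n = triangle (pi1 n + pi2 n) + pi1 n" for n
    using prod_decode_inverse[of n] by (simp add: prod_encode_def case_prod_beta)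
  have 1: "pi1 n = n - triangle (?s n)" and 2: "pi2 n = ?s n - (n - triangle (?s n))" for n
    unfolding diagonal_rec using eq[of n] by linarith+
  show "recursive k (\<lambda>xs. pi1 (f xs))" "recursive k (\<lambda>xs. pi2 (f xs))"
    unfolding 1 2 by (intro recursive_diff recursive_triangle f s)+
qed

section \<open>Computable functions and decidable predicates of one argument\<close>

definition computable :: "(nat \<Rightarrow> nat) \<Rightarrow> bool" where
  "computable f \<longleftrightarrow> recursive 1 (\<lambda>xs. f (xs ! 0))"

lemma computable_id: "computable (\<lambda>n. n)"
  unfolding computable_def by (intro recursive_nth) auto

lemma computable_const: "computable (\<lambda>_. c)"
  unfolding computable_def by (rule recursive_const)

lemma computable_Suc: "computable f \<Longrightarrow> computable (\<lambda>n. Suc (f n))"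
  unfolding computable_def by (rule recursive_Suc)

lemma computable_add: "computable f \<Longrightarrow> computable g \<Longrightarrow> computable (\<lambda>n. f n + g n)"
  unfolding computable_def by (rule recursive_add)

lemma computable_diff: "computable f \<Longrightarrow> computable g \<Longrightarrow> computable (\<lambda>n. f n - g n)"
  unfolding computable_def by (rule recursive_diff)

lemma computable_mult: "computable f \<Longrightarrow> computable g \<Longrightarrow> computable (\<lambda>n. f n * g n)"
  unfolding computable_def by (rule recursive_mult)

lemma computable_pi1: "computable f \<Longrightarrow> computable (\<lambda>n. pi1 (f n))"
  unfolding computable_def by (rule recursive_pi1)

lemma computable_pi2: "computable f \<Longrightarrow> computable (\<lambda>n. pi2 (f n))"
  unfolding computable_def by (rule recursive_pi2)

lemma computable_pair:
  "computable f \<Longrightarrow> computable g \<Longrightarrow> computable (\<lambda>n. prod_encode (f n, g n))"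
  unfolding computable_def prod_encode_def prod.case
  by (intro recursive_add recursive_triangle)

lemma computable_compose: "computable f \<Longrightarrow> computable g \<Longrightarrow> computable (\<lambda>n. f (g n))"
  unfolding computable_def by (rule recursive_compose1)

text \<open>Several arguments are packed by \<open>prod_encode\<close>: \<open>p\<close> holds the
  parameter, the counter and the previous value, in this order.\<close>

lemma computable_rec_nat:
  assumes "computable a" "computable m"
    and h: "computable (\<lambda>p. h (pi1 p) (pi1 (pi2 p)) (pi2 (pi2 p)))"
  shows "computable (\<lambda>x. rec_nat (a x) (h x) (m x))"
  unfolding computable_def
proof (rule recursive_rec_nat)
  have "recursive (Suc (Suc 1)) (\<lambda>xs. prod_encode (xs ! 2, prod_encode (xs ! 0, xs ! 1)))"
    unfolding prod_encode_def prod.case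
    by (intro recursive_add recursive_triangle recursive_nth) auto
  from recursive_compose1[OF h[unfolded computable_def] this]
  have "recursive (Suc (Suc 1)) (\<lambda>xs. h (xs ! 2) (xs ! 0) (xs ! 1))" by simp
  then show "recursive (Suc (Suc 1)) (\<lambda>xs. h (drop 2 xs ! 0) (xs ! 0) (xs ! 1))"
    by (rule recursive_cong) simp
qed (use assms in \<open>auto simp: computable_def\<close>)

lemma computable_power: "computable f \<Longrightarrow> computable g \<Longrightarrow> computable (\<lambda>n. f n ^ g n)"
proof -
  assume f: "computable f" and g: "computable g"
  have "computable (\<lambda>x. rec_nat 1 (\<lambda>_ s. s * f x) (g x))"
    by (intro computable_rec_nat computable_mult computable_pi1 computable_pi2 computable_id
        computable_const g computable_compose[OF f])
  moreover have "rec_nat 1 (\<lambda>_ s. s * a) n = a ^ n" for a n :: nat by (induction n) auto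
  ultimately show ?thesis by simp
qed

definition decidable :: "(nat \<Rightarrow> bool) \<Rightarrow> bool" where
  "decidable P \<longleftrightarrow> computable (\<lambda>n. of_bool (P n))"

lemma decidable_not: "decidable P \<Longrightarrow> decidable (\<lambda>n. \<not> P n)"
proof -
  assume "decidable P"
  then have "computable (\<lambda>n. 1 - of_bool (P n))"
    unfolding decidable_def by (intro computable_diff computable_const)
  moreover have "(\<lambda>n. 1 - of_bool (P n) :: nat) = (\<lambda>n. of_bool (\<not> P n))" by auto
  ultimately show ?thesis unfolding decidable_def by simp
qed

lemma decidable_conj: "decidable P \<Longrightarrow> decidable Q \<Longrightarrow> decidable (\<lambda>n. P n \<and> Q n)"
  unfolding decidable_def of_bool_conj by (rule computable_mult)

lemma decidable_disj: "decidable P \<Longrightarrow> decidable Q \<Longrightarrow> decidable (\<lambda>n. P n \<or> Q n)"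
  using decidable_not[OF decidable_conj[OF decidable_not decidable_not]] by simp

lemma decidable_const: "decidable (\<lambda>n. P)"
  unfolding decidable_def by (rule computable_const)

lemma decidable_le:
  assumes "computable f" "computable g"
  shows "decidable (\<lambda>n. f n \<le> g n)"
proof -
  have "computable (\<lambda>n. 1 - (f n - g n))"
    by (intro computable_diff computable_const assms)
  moreover have "(\<lambda>n. 1 - (f n - g n)) = (\<lambda>n. of_bool (f n \<le> g n))" by auto
  ultimately show ?thesis unfolding decidable_def by simp
qed

lemma decidable_less: "computable f \<Longrightarrow> computable g \<Longrightarrow> decidable (\<lambda>n. f n < g n)"
  unfolding less_eq_Suc_le by (intro decidable_le computable_Suc)

text \<open>It is enough to expose some accepted \<open>k\<close>: the caller will show that every
  accepted \<open>k\<close> yields the correct answer.\<close>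

lemma computes_search:
  assumes c: "decidable (\<lambda>p. c (pi1 p) (pi2 p))" and ans: "decidable (\<lambda>p. ans (pi1 p) (pi2 p))"
  shows "\<exists>F. \<forall>n. (\<exists>k. c n k) \<longrightarrow> (\<exists>k. c n k \<and> computes F [n] (if ans n k then 1 else 0))"
proof -
  have swap: "recursive 2 (\<lambda>xs. prod_encode (xs ! 1, xs ! 0))"
    and id: "recursive 2 (\<lambda>xs. prod_encode (xs ! 0, xs ! 1))"
    unfolding prod_encode_def prod.case
    by (intro recursive_add recursive_triangle recursive_nth; simp)+
  \<comment> \<open>\<open>Mu\<close> has its search variable in front and stops at the value 0,
    hence the swapped arguments and the negation.\<close>
  obtain C where C: "\<And>xs. length xs = 2 \<Longrightarrow> computes C xs (of_bool (\<not> c (xs ! 1) (xs ! 0)))"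
    using recursive_compose1[OF decidable_not[OF c, unfolded decidable_def computable_def] swap]
    unfolding recursive_def by auto
  obtain A where A: "\<And>xs. length xs = 2 \<Longrightarrow> computes A xs (of_bool (ans (xs ! 0) (xs ! 1)))"
    using recursive_compose1[OF ans[unfolded decidable_def computable_def] id]
    unfolding recursive_def by auto
  show ?thesis
  proof (intro exI[of _ "Comp A [Proj 0, Mu C]"] allI impI)
    fix n assume ex: "\<exists>k. c n k"
    define k where "k = (LEAST k. c n k)"
    have k: "c n k" using ex unfolding k_def by (rule LeastI_ex)
    have "computes (Mu C) [n] k"
    proof (rule computes.mu)
      show "computes C [k, n] 0" using C[of "[k, n]"] k by simp
      show "\<forall>m<k. \<exists>y. computes C [m, n] (Suc y)"
      proof (intro allI impI)
        fix m assume "m < k"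
        then have "\<not> c n m" using not_less_Least unfolding k_def by blast
        then have "computes C [m, n] (Suc 0)" using C[of "[m, n]"] by simp
        then show "\<exists>y. computes C [m, n] (Suc y)" by blast
      qed
    qed
    moreover have "computes (Proj 0) [n] n" using computes.proj[of 0 "[n]"] by simp
    ultimately have "computes (Comp A [Proj 0, Mu C]) [n] (of_bool (ans n k))"
      using A[of "[n, k]"] by (intro computes.comp[of "[n]" _ "[n, k]"]) auto
    with k show "\<exists>k. c n k \<and> computes (Comp A [Proj 0, Mu C]) [n] (if ans n k then 1 else 0)"
      by (auto simp: of_bool_def)
  qed
qed

section \<open>Functions with rational and Gaussian rational values\<close>

definition represented :: "(nat \<Rightarrow> 'a) \<Rightarrow> (nat \<Rightarrow> 'a) \<Rightarrow> bool" where
  "represented \<delta> f \<longleftrightarrow> (\<exists>g. computable g \<and> (\<forall>n. f n = \<delta> (g n)))"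

lemma represented_compose: "represented \<delta> f \<Longrightarrow> computable g \<Longrightarrow> represented \<delta> (\<lambda>n. f (g n))"
  unfolding represented_def by (metis (no_types, lifting) computable_compose)

lemma represented_decode: "computable g \<Longrightarrow> represented \<delta> (\<lambda>n. \<delta> (g n))"
  unfolding represented_def by blast

text \<open>The recursion runs on codes; since \<open>h\<close> sees only the decoded value, it does
  not matter that a number has many codes.\<close>

lemma represented_rec_nat:
  assumes a: "represented \<delta> a" and m: "computable m"
    and h: "represented \<delta> (\<lambda>p. h (pi1 p) (pi1 (pi2 p)) (\<delta> (pi2 (pi2 p))))"
  shows "represented \<delta> (\<lambda>x. rec_nat (a x) (h x) (m x))"
proof -
  obtain a' where a': "computable a'" "\<And>n. a n = \<delta> (a' n)"
    using a unfolding represented_def by blast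
  obtain H where H: "computable H" "\<And>p. h (pi1 p) (pi1 (pi2 p)) (\<delta> (pi2 (pi2 p))) = \<delta> (H p)"
    using h unfolding represented_def by blast
  define H' where "H' x j s = H (prod_encode (x, prod_encode (j, s)))" for x j s
  have H': "h x j (\<delta> s) = \<delta> (H' x j s)" for x j s
    using H(2)[of "prod_encode (x, prod_encode (j, s))"] by (simp add: H'_def)
  have "rec_nat (a x) (h x) n = \<delta> (rec_nat (a' x) (H' x) n)" for x n
    by (induction n) (simp_all add: a'(2) H')
  moreover have "computable (\<lambda>x. rec_nat (a' x) (H' x) (m x))"
    by (intro computable_rec_nat a' m) (simp add: H'_def H(1))
  ultimately show ?thesis unfolding represented_def by blast
qed

abbreviation rational_fun :: "(nat \<Rightarrow> real) \<Rightarrow> bool" where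
  "rational_fun \<equiv> represented rat_decode"

text \<open>With a difference of naturals over a positive denominator, the ring operations and
  comparisons reduce to arithmetic on naturals without case distinctions on signs.\<close>

lemma rational_fun_iff:
  "rational_fun f \<longleftrightarrow> (\<exists>p q d. computable p \<and> computable q \<and> computable d \<and>
     (\<forall>n. f n = (real (p n) - real (q n)) / real (Suc (d n))))"
proof
  assume "rational_fun f"
  then obtain g where g: "computable g" "\<And>n. f n = rat_decode (g n)"
    unfolding represented_def by blast
  \<comment> \<open>\<open>?h\<close> is division by 2, from
    \<open>Suc m div 2 = m - m div 2\<close>. Even codes \<open>2 * b\<close> stand for
    \<open>b\<close> and odd codes \<open>2 * b + 1\<close> for \<open>- b - 1\<close>; the parity
    \<open>m - 2 * ?h m\<close> selects between \<open>?p\<close> and \<open>?q\<close>.\<close>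
  let ?h = "\<lambda>m. rec_nat 0 (\<lambda>j s. j - s) m"
  let ?m = "\<lambda>n. pi1 (g n)"
  let ?p = "\<lambda>n. (1 - (?m n - 2 * ?h (?m n))) * ?h (?m n)"
  let ?q = "\<lambda>n. (?m n - 2 * ?h (?m n)) * Suc (?h (?m n))"
  have h: "?h m = m div 2" for m
  proof (induction m)
    case (Suc m)
    have "?h (Suc m) = m - m div 2" using Suc by simp
    then show ?case by presburger
  qed simp
  have int: "real_of_int (int_decode m)
      = real ((1 - (m - 2 * ?h m)) * ?h m) - real ((m - 2 * ?h m) * Suc (?h m))" for m
  proof (cases "even m")
    case True
    then show ?thesis by (auto simp: h int_decode_def sum_decode_def)
  next
    case False
    then obtain b where "m = 2 * b + 1" by (elim oddE)
    then show ?thesis by (simp add: h int_decode_def sum_decode_def)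
  qed
  have "computable (\<lambda>n. ?h (?m n))"
    by (intro computable_rec_nat computable_const computable_diff computable_pi1 computable_pi2
        computable_id g)
  then have "computable ?p \<and> computable ?q \<and> computable (\<lambda>n. pi2 (g n))"
    by (intro conjI computable_mult computable_diff computable_Suc computable_const computable_pi1
        computable_pi2 g)
  moreover have "f n = (real (?p n) - real (?q n)) / real (Suc (pi2 (g n)))" for n
    unfolding g(2) rat_decode_def case_prod_beta int ..
  ultimately show "\<exists>p q d. computable p \<and> computable q \<and> computable d \<and>
     (\<forall>n. f n = (real (p n) - real (q n)) / real (Suc (d n)))" by blast
next
  assume "\<exists>p q d. computable p \<and> computable q \<and> computable d \<and>
     (\<forall>n. f n = (real (p n) - real (q n)) / real (Suc (d n)))"
  then obtain p q d where c: "computable p" "computable q" "computable d"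
    and f: "\<And>n. f n = (real (p n) - real (q n)) / real (Suc (d n))" by blast
  \<comment> \<open>At most one of the truncated differences is nonzero, and the code of
    \<open>- k\<close> for \<open>k > 0\<close> is \<open>2 * k - 1\<close>.\<close>
  have enc: "int_decode (2 * (a - b) + (2 * (b - a) - 1)) = int a - int b" for a b
  proof -
    have "2 * (a - b) + (2 * (b - a) - 1) = int_encode (int a - int b)"
      by (auto simp: int_encode_def sum_encode_def nat_diff_distrib)
    then show ?thesis by simp
  qed
  let ?g = "\<lambda>n. prod_encode (2 * (p n - q n) + (2 * (q n - p n) - 1), d n)"
  have "computable ?g"
    by (intro computable_pair computable_add computable_mult computable_diff computable_const c)
  moreover have "f n = rat_decode (?g n)" for n
    unfolding f rat_decode_def prod_encode_inverse prod.case enc by simp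
  ultimately show "rational_fun f" unfolding represented_def by blast
qed

lemma rational_fun_of_nat: "computable f \<Longrightarrow> rational_fun (\<lambda>n. real (f n))"
  unfolding rational_fun_iff
  by (intro exI[of _ f] exI[of _ "\<lambda>_. 0"]) (auto intro: computable_const)

lemma rational_fun_const: "rational_fun (\<lambda>_. real c)"
  by (intro rational_fun_of_nat computable_const)

lemma rational_fun_inverse_Suc: "computable f \<Longrightarrow> rational_fun (\<lambda>n. 1 / real (Suc (f n)))"
  unfolding rational_fun_iff
  by (intro exI[of _ "\<lambda>_. 1"] exI[of _ "\<lambda>_. 0"] exI[of _ f]) (auto intro: computable_const)

lemma rational_fun_int_decode:
  assumes "computable f" shows "rational_fun (\<lambda>n. of_int (int_decode (f n)))"
proof -
  have "rational_fun (\<lambda>n. rat_decode (prod_encode (f n, 0)))"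
    by (intro represented_decode computable_pair computable_const assms)
  then show ?thesis by (simp add: rat_decode_def)
qed

lemma rational_fun_uminus: "rational_fun f \<Longrightarrow> rational_fun (\<lambda>n. - f n)"
proof -
  assume "rational_fun f"
  then obtain p q d where c: "computable p" "computable q" "computable d"
    and f: "\<And>n. f n = (real (p n) - real (q n)) / real (Suc (d n))"
    unfolding rational_fun_iff by blast
  then show ?thesis unfolding rational_fun_iff
    by (intro exI[of _ q] exI[of _ p] exI[of _ d]) (auto simp: field_simps simp del: of_nat_Suc)
qed

lemma rational_fun_add: "rational_fun f \<Longrightarrow> rational_fun g \<Longrightarrow> rational_fun (\<lambda>n. f n + g n)"
  and rational_fun_mult: "rational_fun f \<Longrightarrow> rational_fun g \<Longrightarrow> rational_fun (\<lambda>n. f n * g n)"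
  and decidable_rational_less: "rational_fun f \<Longrightarrow> rational_fun g \<Longrightarrow> decidable (\<lambda>n. f n < g n)"
proof -
  assume "rational_fun f" "rational_fun g"
  then obtain p q d p' q' d' where c: "computable p" "computable q" "computable d"
      "computable p'" "computable q'" "computable d'"
    and f: "\<And>n. f n = (real (p n) - real (q n)) / real (Suc (d n))"
    and g: "\<And>n. g n = (real (p' n) - real (q' n)) / real (Suc (d' n))"
    unfolding rational_fun_iff by blast
  \<comment> \<open>Denominators are stored with 1 subtracted; \<open>Suc (?e n)\<close> is the
    product of the two.\<close>
  let ?e = "\<lambda>n. d n * Suc (d' n) + d' n"
  have e: "real (Suc (?e n)) = real (Suc (d n)) * real (Suc (d' n))" for n
    by (simp add: algebra_simps)
  have "computable (\<lambda>n. p n * Suc (d' n) + p' n * Suc (d n))"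
    "computable (\<lambda>n. q n * Suc (d' n) + q' n * Suc (d n))" "computable ?e"
    "computable (\<lambda>n. p n * p' n + q n * q' n)" "computable (\<lambda>n. p n * q' n + q n * p' n)"
    by (intro computable_add computable_mult computable_Suc c)+
  note C = this
  show "rational_fun (\<lambda>n. f n + g n)"
    unfolding rational_fun_iff f g
    by (intro exI conjI allI, rule C(1), rule C(2), rule C(3))
      (simp only: e of_nat_add of_nat_mult, simp add: field_simps del: of_nat_Suc)
  show "rational_fun (\<lambda>n. f n * g n)"
    unfolding rational_fun_iff f g
    by (intro exI conjI allI, rule C(4), rule C(5), rule C(3))
      (simp only: e of_nat_add of_nat_mult, simp add: field_simps del: of_nat_Suc)
  have "decidable (\<lambda>n. p n * Suc (d' n) + q' n * Suc (d n) < p' n * Suc (d n) + q n * Suc (d' n))"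
    by (intro decidable_less computable_add computable_mult computable_Suc c)
  also have "(\<lambda>n. p n * Suc (d' n) + q' n * Suc (d n) < p' n * Suc (d n) + q n * Suc (d' n))
      = (\<lambda>n. f n < g n)"
  proof
    fix n
    have "f n < g n \<longleftrightarrow> (real (p n) - real (q n)) * real (Suc (d' n)) < (real (p' n) - real (q' n)) * real (Suc (d n))"
      unfolding f g by (subst divide_less_eq, simp, subst pos_less_divide_eq[symmetric], simp)
        (simp add: mult.commute)
    also have "\<dots> \<longleftrightarrow> real (p n * Suc (d' n) + q' n * Suc (d n)) < real (p' n * Suc (d n) + q n * Suc (d' n))"
      by (simp add: algebra_simps)
    finally show "(p n * Suc (d' n) + q' n * Suc (d n) < p' n * Suc (d n) + q n * Suc (d' n)) = (f n < g n)"
      by (simp only: of_nat_less_iff)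
  qed
  finally show "decidable (\<lambda>n. f n < g n)" .
qed

lemma rational_fun_diff: "rational_fun f \<Longrightarrow> rational_fun g \<Longrightarrow> rational_fun (\<lambda>n. f n - g n)"
  using rational_fun_add[OF _ rational_fun_uminus] by simp

definition gauss_decode :: "nat \<Rightarrow> complex" where
  "gauss_decode n = Complex (rat_decode (pi1 n)) (rat_decode (pi2 n))"

abbreviation gauss_fun :: "(nat \<Rightarrow> complex) \<Rightarrow> bool" where
  "gauss_fun \<equiv> represented gauss_decode"

lemma gauss_fun_iff: "gauss_fun f \<longleftrightarrow> rational_fun (\<lambda>n. Re (f n)) \<and> rational_fun (\<lambda>n. Im (f n))"
proof
  assume "gauss_fun f"
  then obtain g where "computable g" "\<And>n. f n = gauss_decode (g n)"
    unfolding represented_def by blast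
  then show "rational_fun (\<lambda>n. Re (f n)) \<and> rational_fun (\<lambda>n. Im (f n))"
    by (auto simp: gauss_decode_def intro!: represented_decode computable_pi1 computable_pi2)
next
  assume "rational_fun (\<lambda>n. Re (f n)) \<and> rational_fun (\<lambda>n. Im (f n))"
  then obtain g h where "computable g" "\<And>n. Re (f n) = rat_decode (g n)"
      "computable h" "\<And>n. Im (f n) = rat_decode (h n)"
    unfolding represented_def by blast
  then show "gauss_fun f" unfolding represented_def
    by (intro exI[of _ "\<lambda>n. prod_encode (g n, h n)"])
      (auto intro: computable_pair complex_eqI simp: gauss_decode_def)
qed

lemma gauss_fun_add: "gauss_fun f \<Longrightarrow> gauss_fun g \<Longrightarrow> gauss_fun (\<lambda>n. f n + g n)"
  and gauss_fun_uminus: "gauss_fun f \<Longrightarrow> gauss_fun (\<lambda>n. - f n)"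
  and gauss_fun_diff: "gauss_fun f \<Longrightarrow> gauss_fun g \<Longrightarrow> gauss_fun (\<lambda>n. f n - g n)"
  and gauss_fun_mult: "gauss_fun f \<Longrightarrow> gauss_fun g \<Longrightarrow> gauss_fun (\<lambda>n. f n * g n)"
  and gauss_fun_cnj: "gauss_fun f \<Longrightarrow> gauss_fun (\<lambda>n. cnj (f n))"
  and gauss_fun_of_real: "rational_fun r \<Longrightarrow> gauss_fun (\<lambda>n. of_real (r n))"
  unfolding gauss_fun_iff
  using rational_fun_const[of 0]
  by (auto intro: rational_fun_add rational_fun_diff rational_fun_mult rational_fun_uminus)

lemma gauss_fun_int_decode: "computable f \<Longrightarrow> gauss_fun (\<lambda>n. of_int (int_decode (f n)))"
  using gauss_fun_of_real[OF rational_fun_int_decode] by simp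

lemma gauss_fun_power:
  assumes "gauss_fun f" "computable k" shows "gauss_fun (\<lambda>n. f n ^ k n)"
proof -
  have "gauss_fun (\<lambda>x. rec_nat (of_real (real 1)) (\<lambda>_ s. s * f x) (k x))"
    by (intro represented_rec_nat gauss_fun_mult represented_decode computable_pi1 computable_pi2
        computable_id gauss_fun_of_real rational_fun_const assms represented_compose[OF assms(1)])
  moreover have "rec_nat (of_real (real 1)) (\<lambda>_ s. s * a) n = a ^ n" for a :: complex and n
    by (induction n) auto
  ultimately show ?thesis by simp
qed

lemma gauss_fun_sum:
  assumes "gauss_fun (\<lambda>p. f (pi1 p) (pi2 p))" "computable k"
  shows "gauss_fun (\<lambda>n. \<Sum>j<k n. f n j)"
proof -
  have "gauss_fun (\<lambda>p. f (pi1 p) (pi1 (pi2 p)))"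
    using represented_compose[OF assms(1), of "\<lambda>p. prod_encode (pi1 p, pi1 (pi2 p))"]
    by (simp add: computable_pair computable_pi1 computable_pi2 computable_id)
  then have "gauss_fun (\<lambda>x. rec_nat (of_real (real 0)) (\<lambda>j s. s + f x j) (k x))"
    by (intro represented_rec_nat gauss_fun_add represented_decode computable_pi1 computable_pi2
        computable_id gauss_fun_of_real rational_fun_const assms)
  moreover have "rec_nat (of_real (real 0)) (\<lambda>j s. s + f x j) n = (\<Sum>j<n. f x j)" for x n
    by (induction n) auto
  ultimately show ?thesis by simp
qed

text \<open>The modulus of a Gaussian rational may be irrational, so the tests on moduli below go
  through squares.\<close>

lemma rational_fun_cmod_square:
  assumes "gauss_fun f" shows "rational_fun (\<lambda>n. (cmod (f n))\<^sup>2)"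
proof -
  have "rational_fun (\<lambda>n. Re (f n) * Re (f n) + Im (f n) * Im (f n))"
    using assms unfolding gauss_fun_iff by (intro rational_fun_add rational_fun_mult) auto
  then show ?thesis by (simp only: cmod_power2 power2_eq_square[of "Re _"] power2_eq_square[of "Im _"])
qed

section \<open>Entries of coded lists and sizes of decoded numbers\<close>

definition list_entry :: "nat \<Rightarrow> nat \<Rightarrow> nat" where
  "list_entry n j = pi1 (rec_nat n (\<lambda>_ m. pi2 (m - 1)) j - 1)"

lemma pi_0: "pi1 0 = 0" "pi2 0 = 0"
  using prod_encode_inverse[of "(0, 0)"] by (simp_all add: prod_encode_def)

text \<open>The code of a nonempty list is the successor of a pair, hence the \<open>- 1\<close> in
  \<open>list_entry\<close>. Past the end, the code 0 of the empty list reproduces itself because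
  \<open>pi2 0 = 0\<close>; the default 0 suits coefficient lists, as
  \<open>int_decode 0 = 0\<close>.\<close>

lemma list_entry_encode: "list_entry (list_encode xs) j = nth_default 0 xs j"
proof -
  have "rec_nat (list_encode xs) (\<lambda>_ m. pi2 (m - 1)) j = list_encode (drop j xs)"
  proof (induction j)
    case (Suc j)
    then show ?case by (cases "drop j xs") (auto simp: pi_0 drop_Suc drop_tl)
  qed simp
  then show ?thesis
    by (cases "j < length xs")
      (simp_all add: list_entry_def nth_default_def pi_0 Cons_nth_drop_Suc[symmetric])
qed

lemma computable_list_entry:
  assumes "computable f" "computable g" shows "computable (\<lambda>n. list_entry (f n) (g n))"
  unfolding list_entry_def
  by (intro computable_pi1 computable_diff computable_const computable_rec_nat computable_pi2
      computable_id assms)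

lemma pi_le: "pi1 n \<le> n" "pi2 n \<le> n"
  using le_prod_encode_1[of "pi1 n" "pi2 n"] le_prod_encode_2[of "pi2 n" "pi1 n"] by auto

text \<open>Together with the bounds that follow, this lets the code itself act as the size
  parameter of all estimates.\<close>

lemma list_entry_le: "list_entry n j \<le> n"
proof -
  have "rec_nat n (\<lambda>_ m. pi2 (m - 1)) j \<le> n"
    by (induction j) (auto intro: order.trans[OF pi_le(2)])
  then show ?thesis unfolding list_entry_def using pi_le(1) le_trans diff_le_self by blast
qed

lemma length_le_list_encode: "length xs \<le> list_encode xs"
  by (induction xs) (auto intro: order.trans[OF _ le_prod_encode_2])

lemma abs_int_decode_le: "\<bar>int_decode n\<bar> \<le> int n"
  by (auto simp: int_decode_def sum_decode_def) presburger+

lemma abs_rat_decode_le: "\<bar>rat_decode n\<bar> \<le> real n"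
proof -
  have "\<bar>rat_decode n\<bar> \<le> \<bar>real_of_int (int_decode (pi1 n))\<bar>"
    by (simp add: rat_decode_def case_prod_beta divide_le_eq mult_le_cancel_left1)
  also have "\<dots> \<le> real n"
    using abs_int_decode_le[of "pi1 n"] pi_le(1)[of n] by linarith
  finally show ?thesis .
qed

lemma gauss_decode_approx:
  assumes "e > 0" shows "\<exists>n. cmod (gauss_decode n - z) < e"
proof -
  obtain a where a: "\<bar>rat_decode a - Re z\<bar> < e / 2"
    using Rats_approx[of "e / 2" "Re z"] assms by auto
  obtain b where b: "\<bar>rat_decode b - Im z\<bar> < e / 2"
    using Rats_approx[of "e / 2" "Im z"] assms by auto
  have "cmod (gauss_decode (prod_encode (a, b)) - z) < e"
    using cmod_le[of "gauss_decode (prod_encode (a, b)) - z"] a b by (simp add: gauss_decode_def)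
  then show ?thesis ..
qed

section \<open>A lower bound for nonzero algebraic numbers\<close>

text \<open>Lattice elements of height at most \<open>h\<close>. The set \<open>V\<close> may be
  linearly dependent, so only the existence of suitable coefficients is recorded.\<close>

definition int_span :: "complex set \<Rightarrow> nat \<Rightarrow> complex set" where
  "int_span V h = {\<Sum>y\<in>V. of_int (m y) * y | m :: complex \<Rightarrow> int. (\<Sum>y\<in>V. \<bar>m y\<bar>) \<le> int h}"

lemma int_span_add: "x \<in> int_span V h \<Longrightarrow> y \<in> int_span V k \<Longrightarrow> x + y \<in> int_span V (h + k)"
proof -
  assume "x \<in> int_span V h" "y \<in> int_span V k"
  then obtain m l where m: "(\<Sum>y\<in>V. \<bar>m y\<bar>) \<le> int h" "x = (\<Sum>y\<in>V. of_int (m y) * y)"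
    and l: "(\<Sum>y\<in>V. \<bar>l y\<bar>) \<le> int k" "y = (\<Sum>y\<in>V. of_int (l y) * y)"
    unfolding int_span_def by blast
  have "(\<Sum>y\<in>V. \<bar>m y + l y\<bar>) \<le> (\<Sum>y\<in>V. \<bar>m y\<bar> + \<bar>l y\<bar>)" by (intro sum_mono abs_triangle_ineq)
  also have "\<dots> \<le> int (h + k)" using m(1) l(1) by (simp add: sum.distrib)
  finally show ?thesis unfolding int_span_def
    by (intro CollectI exI[of _ "\<lambda>y. m y + l y"]) (simp add: m(2) l(2) sum.distrib distrib_right)
qed

lemma int_span_mono: "x \<in> int_span V h \<Longrightarrow> h \<le> k \<Longrightarrow> x \<in> int_span V k"
  unfolding int_span_def by force

lemma int_span_0: "0 \<in> int_span V h"
  unfolding int_span_def by (intro CollectI exI[of _ "\<lambda>_. 0"]) simp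

lemma int_span_mult_int:
  assumes "x \<in> int_span V h" shows "of_int c * x \<in> int_span V (nat \<bar>c\<bar> * h)"
proof -
  obtain m where m: "(\<Sum>y\<in>V. \<bar>m y\<bar>) \<le> int h" "x = (\<Sum>y\<in>V. of_int (m y) * y)"
    using assms unfolding int_span_def by blast
  have "(\<Sum>y\<in>V. \<bar>c * m y\<bar>) \<le> int (nat \<bar>c\<bar> * h)"
    using mult_left_mono[OF m(1), of "\<bar>c\<bar>"] by (simp add: abs_mult sum_distrib_left)
  then show ?thesis unfolding int_span_def
    by (intro CollectI exI[of _ "\<lambda>y. c * m y"]) (simp add: m(2) sum_distrib_left mult.assoc)
qed

lemma int_span_mult_nat: "x \<in> int_span V h \<Longrightarrow> of_nat c * x \<in> int_span V (c * h)"
  using int_span_mult_int[of x V h "int c"] by simp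

lemma int_span_sum:
  "(\<And>i. i \<in> I \<Longrightarrow> f i \<in> int_span V (h i)) \<Longrightarrow> (\<Sum>i\<in>I. f i) \<in> int_span V (\<Sum>i\<in>I. h i)"
  by (induction I rule: infinite_finite_induct) (auto intro: int_span_add int_span_0)

lemma int_span_base: "finite V \<Longrightarrow> y \<in> V \<Longrightarrow> y \<in> int_span V 1"
proof -
  assume V: "finite V" "y \<in> V"
  have "(\<Sum>z\<in>V. of_int (of_bool (z = y)) * z) = y"
    "(\<Sum>z\<in>V. \<bar>of_bool (z = y)\<bar> :: int) = 1"
    using V sum.delta[of V y "\<lambda>_. y"] sum.delta[of V y "\<lambda>_. 1 :: int"]
    by (auto simp: of_bool_def if_distrib if_distribR cong: if_cong)
  then show ?thesis unfolding int_span_def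
    by (intro CollectI exI[of _ "\<lambda>z. of_bool (z = y)"]) simp
qed

text \<open>Measured by the sum of absolute coefficients, heights simply multiply, with no factor
  for the size of \<open>V\<close>.\<close>

lemma int_span_map:
  assumes x: "x \<in> int_span W h" and t: "\<And>w. w \<in> W \<Longrightarrow> t * w \<in> int_span V k"
  shows "t * x \<in> int_span V (h * k)"
proof -
  obtain m where m: "(\<Sum>y\<in>W. \<bar>m y\<bar>) \<le> int h" "x = (\<Sum>y\<in>W. of_int (m y) * y)"
    using x unfolding int_span_def by blast
  have "(\<Sum>y\<in>W. of_int (m y) * (t * y)) \<in> int_span V (\<Sum>y\<in>W. nat \<bar>m y\<bar> * k)"
    by (intro int_span_sum int_span_mult_int t)
  moreover have "(\<Sum>y\<in>W. nat \<bar>m y\<bar> * k) \<le> h * k"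
  proof -
    have "int (\<Sum>y\<in>W. nat \<bar>m y\<bar>) \<le> int h" using m(1) by simp
    then have "(\<Sum>y\<in>W. nat \<bar>m y\<bar>) \<le> h" by linarith
    then show ?thesis by (simp add: sum_distrib_right[symmetric])
  qed
  moreover have "t * x = (\<Sum>y\<in>W. of_int (m y) * (t * y))"
    by (simp add: m(2) sum_distrib_left mult.left_commute)
  ultimately show ?thesis by (auto intro: int_span_mono)
qed

text \<open>Multiplication by \<open>c * z\<close> maps the lattice generated by \<open>V\<close>
  into itself; if \<open>1 \<in> V\<close>, then \<open>c * z\<close> is an eigenvalue of an integer
  matrix with absolute row sums at most \<open>h\<close>. The denominator \<open>c\<close> is there
  because \<open>z\<close> may fail to be an algebraic integer.\<close>

definition stabilizes :: "complex set \<Rightarrow> nat \<Rightarrow> nat \<Rightarrow> complex \<Rightarrow> bool" where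
  "stabilizes V h c z \<longleftrightarrow> (\<forall>x\<in>V. of_nat c * z * x \<in> int_span V h)"

lemma stabilizes_mono: "stabilizes V h c z \<Longrightarrow> h \<le> k \<Longrightarrow> stabilizes V k c z"
  unfolding stabilizes_def using int_span_mono by blast

lemma stabilizes_uminus: "stabilizes V h c z \<Longrightarrow> stabilizes V h c (- z)"
  unfolding stabilizes_def using int_span_mult_int[of _ V h "-1"] by force

lemma stabilizes_scale: "stabilizes V h c z \<Longrightarrow> stabilizes V (d * h) (d * c) z"
  unfolding stabilizes_def using int_span_mult_nat[of _ V h d] by (force simp: mult.assoc)

lemma stabilizes_add:
  assumes "stabilizes V h c z" "stabilizes V k c w" shows "stabilizes V (h + k) c (z + w)"
  using assms int_span_add unfolding stabilizes_def by (simp add: distrib_left distrib_right)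

lemma stabilizes_mult:
  assumes z: "stabilizes V h c z" and w: "stabilizes V k d w"
  shows "stabilizes V (k * h) (c * d) (z * w)"
  unfolding stabilizes_def
proof
  fix x assume "x \<in> V"
  then have "of_nat c * z * (of_nat d * w * x) \<in> int_span V (k * h)"
    using z w unfolding stabilizes_def by (intro int_span_map[of _ V k]) auto
  then show "of_nat (c * d) * (z * w) * x \<in> int_span V (k * h)" by (simp add: mult_ac)
qed

text \<open>One number bounds both denominator and height, so that a single function can follow
  their growth through a polynomial expression.\<close>

definition stabilized :: "complex set \<Rightarrow> nat \<Rightarrow> complex \<Rightarrow> bool" where
  "stabilized V h z \<longleftrightarrow> (\<exists>c. 1 \<le> c \<and> c \<le> h \<and> stabilizes V h c z)"

lemma stabilized_uminus: "stabilized V h z \<Longrightarrow> stabilized V h (- z)"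
  unfolding stabilized_def using stabilizes_uminus by blast

lemma stabilized_add:
  assumes "stabilized V h z" "stabilized V k w" shows "stabilized V (2 * (h * k)) (z + w)"
proof -
  obtain c d where c: "1 \<le> c" "c \<le> h" "stabilizes V h c z" and d: "1 \<le> d" "d \<le> k" "stabilizes V k d w"
    using assms unfolding stabilized_def by blast
  \<comment> \<open>Passing to the common denominator \<open>c * d\<close> multiplies the height of
    \<open>z\<close> by \<open>d\<close> and that of \<open>w\<close> by \<open>c\<close>.\<close>
  have "stabilizes V (d * h + c * k) (c * d) (z + w)"
    using stabilizes_scale[OF c(3), of d] stabilizes_scale[OF d(3), of c]
    by (intro stabilizes_add) (simp_all add: mult.commute)
  moreover have "d * h + c * k \<le> 2 * (h * k)"
    using add_mono[OF mult_le_mono1[OF d(2), of h] mult_le_mono1[OF c(2), of k]]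
    by (metis mult.commute mult_2)
  moreover have "c * d \<le> h * k" "1 \<le> c * d" using c d by (simp_all add: mult_le_mono)
  ultimately show ?thesis unfolding stabilized_def
    by (intro exI[of _ "c * d"]) (auto intro: stabilizes_mono)
qed

lemma stabilized_mult:
  assumes "stabilized V h z" "stabilized V k w" shows "stabilized V (h * k) (z * w)"
proof -
  obtain c d where c: "1 \<le> c" "c \<le> h" "stabilizes V h c z" and d: "1 \<le> d" "d \<le> k" "stabilizes V k d w"
    using assms unfolding stabilized_def by blast
  then have "c * d \<le> h * k" "1 \<le> c * d" "stabilizes V (h * k) (c * d) (z * w)"
    using stabilizes_mult[OF c(3) d(3)] by (simp_all add: mult_le_mono mult.commute)
  then show ?thesis unfolding stabilized_def by blast
qed

text \<open>Adjoining the powers of a root \<open>\<alpha>\<close> below the degree.\<close>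

lemma stabilizer_insert:
  fixes p :: "int poly"
  assumes p: "p \<noteq> 0" "poly (map_poly of_int p) \<alpha> = (0 :: complex)" "degree p \<le> n"
    "(\<Sum>i\<le>degree p. \<bar>coeff p i\<bar>) \<le> int s"
    and W: "finite W" "1 \<in> W"
  shows "\<exists>V. finite V \<and> 1 \<in> V \<and> card V \<le> n * card W \<and>
    (\<forall>h c z. stabilizes W h c z \<longrightarrow> stabilizes V h c z) \<and>
    stabilized V s \<alpha>"
proof -
  define d where "d = degree p"
  define V where "V = (\<lambda>(i, w). \<alpha> ^ i * w) ` ({..<d} \<times> W)"
  have root: "(\<Sum>i\<le>d. of_int (coeff p i) * \<alpha> ^ i) = 0"
    using p(2) by (simp add: poly_altdef d_def degree_map_poly coeff_map_poly)
  have d: "d > 0"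
  proof (rule ccontr)
    assume "\<not> d > 0"
    with root have "coeff p 0 = 0" by simp
    with p(1) \<open>\<not> d > 0\<close> show False unfolding d_def by (simp add: leading_coeff_0_iff[symmetric] del: leading_coeff_0_iff)
  qed
  have fin: "finite V" using W by (simp add: V_def)
  have one: "1 \<in> V" using d W by (force simp: V_def image_iff intro!: bexI[of _ "(0, 1)"])
  have "card V \<le> card ({..<d} \<times> W)" unfolding V_def using W by (intro card_image_le) auto
  also have "\<dots> \<le> n * card W" using p(3) by (simp add: card_cartesian_product d_def)
  finally have card: "card V \<le> n * card W" .
  have V: "\<alpha> ^ i * w \<in> V" if "i < d" "w \<in> W" for i w
    using that by (force simp: V_def)
  \<comment> \<open>Multiplication by \<open>z\<close> commutes with multiplication by
    \<open>\<alpha> ^ i\<close>, which maps \<open>W\<close> into \<open>V\<close>.\<close>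
  have lift: "stabilizes V h c z" if "stabilizes W h c z" for h c z
    unfolding stabilizes_def
  proof
    fix x assume "x \<in> V"
    then obtain i w where x: "x = \<alpha> ^ i * w" "i < d" "w \<in> W" by (auto simp: V_def)
    have "of_nat c * z * w \<in> int_span W h" using that x(3) by (simp add: stabilizes_def)
    then have "\<alpha> ^ i * (of_nat c * z * w) \<in> int_span V (h * 1)"
      by (rule int_span_map) (intro int_span_base fin V x(2))
    then show "of_nat c * z * x \<in> int_span V h" by (simp add: x mult_ac)
  qed
  \<comment> \<open>After multiplication by the leading coefficient, the relation for
    \<open>\<alpha> ^ d\<close> has integer coefficients.\<close>
  define c where "c = nat \<bar>coeff p d\<bar>"
  have "coeff p d \<noteq> 0" using p(1) by (simp add: d_def)
  then have cpos: "\<bar>coeff p d\<bar> \<ge> 1" by arith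
  have sumd: "(\<Sum>i<d. \<bar>coeff p i\<bar>) + \<bar>coeff p d\<bar> \<le> int s"
    using p(4) unfolding d_def[symmetric] by (simp add: lessThan_Suc_atMost[symmetric])
  moreover have "(\<Sum>i<d. \<bar>coeff p i\<bar>) \<ge> 0" by (intro sum_nonneg) auto
  moreover have "int (\<Sum>i<d. nat \<bar>coeff p i\<bar>) = (\<Sum>i<d. \<bar>coeff p i\<bar>)" "int c = \<bar>coeff p d\<bar>"
    by (simp_all add: c_def)
  ultimately have c: "1 \<le> c" "c \<le> s" "(\<Sum>i<d. nat \<bar>coeff p i\<bar>) \<le> s"
    using cpos by linarith+
  have "stabilizes V s c \<alpha>"
    unfolding stabilizes_def
  proof
    fix x assume "x \<in> V"
    then obtain i w where x: "x = \<alpha> ^ i * w" "i < d" "w \<in> W" by (auto simp: V_def)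
    have "of_int (coeff p d) * \<alpha> * x \<in> int_span V s"
    \<comment> \<open>The product of \<open>\<alpha>\<close> and \<open>\<alpha> ^ i * w\<close> is
      again in \<open>V\<close> unless \<open>i\<close> is the top exponent, where the equation of
      \<open>p\<close> reduces \<open>\<alpha> ^ d\<close>.\<close>
    proof (cases "Suc i < d")
      case True
      have "of_int (coeff p d) * (\<alpha> ^ Suc i * w) \<in> int_span V (nat \<bar>coeff p d\<bar> * 1)"
        by (intro int_span_mult_int int_span_base fin V True x)
      then show ?thesis using c(2) by (auto simp: x mult_ac c_def intro: int_span_mono)
    next
      case False
      then have "d = Suc i" using x by simp
      then have "of_int (coeff p d) * \<alpha> * x = of_int (coeff p d) * \<alpha> ^ d * w" by (simp add: x mult_ac)
      also have "of_int (coeff p d) * \<alpha> ^ d = - (\<Sum>i<d. of_int (coeff p i) * \<alpha> ^ i)"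
        using root by (simp add: lessThan_Suc_atMost[symmetric] eq_neg_iff_add_eq_0 add.commute)
      also have "\<dots> * w = (\<Sum>i<d. of_int (- coeff p i) * (\<alpha> ^ i * w))"
        by (simp add: sum_distrib_right sum_negf mult.assoc)
      also have "\<dots> \<in> int_span V (\<Sum>i<d. nat \<bar>- coeff p i\<bar> * 1)"
        by (intro int_span_sum int_span_mult_int int_span_base fin V x) auto
      finally show ?thesis using c(3) by (auto intro: int_span_mono)
    qed
    then have "of_int (sgn (coeff p d)) * (of_int (coeff p d) * \<alpha> * x) \<in> int_span V (nat \<bar>sgn (coeff p d)\<bar> * s)"
      by (rule int_span_mult_int)
    moreover have "of_int (sgn (coeff p d)) * (of_int (coeff p d) :: complex) = of_nat c"
    proof -
      have "sgn (coeff p d) * coeff p d = int c" by (simp add: c_def sgn_if)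
      then show ?thesis by (metis of_int_mult of_int_of_nat_eq)
    qed
    ultimately show "of_nat c * \<alpha> * x \<in> int_span V s"
      using \<open>coeff p d \<noteq> 0\<close> by (simp add: abs_sgn_eq mult.assoc[symmetric])
  qed
  with c have "stabilized V s \<alpha>" unfolding stabilized_def by blast
  with fin one card lift show ?thesis by blast
qed

section \<open>Explicit lower bounds from the sizes of annihilating polynomials\<close>

definition poly_bounded :: "nat \<Rightarrow> nat \<Rightarrow> complex \<Rightarrow> bool" where
  "poly_bounded n s z \<longleftrightarrow> (\<exists>p :: int poly. p \<noteq> 0 \<and> poly (map_poly of_int p) z = 0 \<and> degree p \<le> n \<and>
     (\<Sum>i\<le>degree p. \<bar>coeff p i\<bar>) \<le> int s)"

lemma poly_bounded_cnj: "poly_bounded n s z \<Longrightarrow> poly_bounded n s (cnj z)"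
proof -
  have "poly (map_poly of_int p) (cnj z) = cnj (poly (map_poly of_int p) z)" for p :: "int poly"
    by (simp add: poly_cnj map_poly_map_poly o_def)
  then show "poly_bounded n s z \<Longrightarrow> poly_bounded n s (cnj z)"
    unfolding poly_bounded_def by (metis complex_cnj_zero)
qed

text \<open>The numbers are adjoined one at a time, starting from \<open>{1}\<close>. Each step
  multiplies the size by at most \<open>n\<close>, and what stabilized the smaller lattice
  stabilizes the larger one with the same constants.\<close>

lemma common_stabilizer:
  assumes "\<And>z. z \<in> set zs \<Longrightarrow> poly_bounded n s z"
  shows "\<exists>V. finite V \<and> 1 \<in> V \<and> card V \<le> n ^ length zs \<and>
     (\<forall>z\<in>set zs. stabilized V s z)"
  using assms
proof (induction zs)
  case Nil
  show ?case by (intro exI[of _ "{1}"]) auto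
next
  case (Cons \<alpha> zs)
  then obtain W where W: "finite W" "1 \<in> W" "card W \<le> n ^ length zs"
    "\<forall>z\<in>set zs. stabilized W s z" by auto
  from Cons.prems[of \<alpha>] obtain p :: "int poly" where
    p: "p \<noteq> 0" "poly (map_poly of_int p) \<alpha> = 0" "degree p \<le> n" "(\<Sum>i\<le>degree p. \<bar>coeff p i\<bar>) \<le> int s"
    unfolding poly_bounded_def by auto
  obtain V where V: "finite V" "1 \<in> V" "card V \<le> n * card W"
    "\<And>h c z. stabilizes W h c z \<Longrightarrow> stabilizes V h c z"
    "stabilized V s \<alpha>"
    using stabilizer_insert[OF p W(1,2)] by blast
  have "card V \<le> n ^ length (\<alpha> # zs)"
    using order.trans[OF V(3) mult_le_mono2[OF W(3)]] by simp
  moreover have "stabilized V s z" if "z \<in> set (\<alpha> # zs)" for z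
    using that V(4,5) W(4) unfolding stabilized_def by (cases "z = \<alpha>") (blast, force)
  ultimately show ?case using V(1,2) by blast
qed

text \<open>Pigeonhole principle: among the integer combinations with coefficients at most \<open>X\<close> of the
  first powers of \<open>\<lambda>\<close>, two agree.\<close>

lemma pigeonhole_relation:
  assumes V: "finite V" "1 \<in> V" "card V \<le> D" and h: "h \<ge> 1"
    and l: "\<And>x. x \<in> V \<Longrightarrow> l * x \<in> int_span V h"
  defines "X \<equiv> (2 * Suc D * h ^ D + 1) ^ D"
  shows "\<exists>b :: nat \<Rightarrow> int. (\<exists>k\<le>D. b k \<noteq> 0) \<and> (\<forall>k. \<bar>b k\<bar> \<le> int X) \<and> (\<Sum>k\<le>D. of_int (b k) * l ^ k) = 0"
proof -
  have pow: "l ^ k \<in> int_span V (h ^ k)" for k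
  proof (induction k)
    case 0
    show ?case using int_span_base[OF V(1,2)] by simp
  next
    case (Suc k)
    from int_span_map[OF this l] show ?case by (simp add: mult.commute)
  qed
  then have "\<forall>k. \<exists>m. (\<Sum>y\<in>V. \<bar>m y\<bar>) \<le> int (h ^ k) \<and> l ^ k = (\<Sum>y\<in>V. of_int (m y) * y)"
    unfolding int_span_def by blast
  then obtain m where m: "\<And>k. (\<Sum>y\<in>V. \<bar>m k y\<bar>) \<le> int (h ^ k)"
    "\<And>k. l ^ k = (\<Sum>y\<in>V. of_int (m k y) * y)" by metis
  \<comment> \<open>\<open>F a\<close> below is a coordinate vector of the combination of powers of
    \<open>l\<close> with coefficients \<open>a\<close>, and \<open>H\<close> bounds its
    entries.\<close>
  define H where "H = Suc D * X * h ^ D"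
  define A where "A = ({..D} \<rightarrow>\<^sub>E {0..int X})"
  define B where "B = (V \<rightarrow>\<^sub>E {- int H..int H})"
  define F where "F a = (\<lambda>y\<in>V. \<Sum>k\<le>D. a k * m k y)" for a :: "nat \<Rightarrow> int"
  have m_le: "\<bar>m k y\<bar> \<le> int (h ^ D)" if "k \<le> D" "y \<in> V" for k y
  proof -
    have "\<bar>m k y\<bar> \<le> (\<Sum>y\<in>V. \<bar>m k y\<bar>)" using V that by (intro member_le_sum) auto
    also have "\<dots> \<le> int (h ^ k)" by (rule m)
    also have "\<dots> \<le> int (h ^ D)" using h that(1) by (simp add: power_increasing del: of_nat_power)
    finally show ?thesis .
  qed
  have F: "F ` A \<subseteq> B"
  proof
    fix f assume "f \<in> F ` A"
    then obtain a where a: "a \<in> A" "f = F a" by blast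
    have "\<bar>\<Sum>k\<le>D. a k * m k y\<bar> \<le> int H" if "y \<in> V" for y
    proof -
      have "\<bar>\<Sum>k\<le>D. a k * m k y\<bar> \<le> (\<Sum>k\<le>D. \<bar>a k * m k y\<bar>)" by (rule sum_abs)
      also have "\<dots> \<le> (\<Sum>k\<le>D. int X * int (h ^ D))"
        unfolding abs_mult using a(1) m_le[OF _ that]
        by (intro sum_mono mult_mono) (auto simp: A_def PiE_def Pi_def)
      also have "\<dots> = int H" by (simp add: H_def algebra_simps)
      finally show ?thesis .
    qed
    then show "f \<in> B" unfolding a(2) F_def B_def
      by (auto simp: abs_le_iff minus_le_iff intro!: PiE_I)
  qed
  have finB: "finite B" unfolding B_def using V(1) by (intro finite_PiE) auto
  have "card B = (2 * H + 1) ^ card V"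
  proof -
    have "card {- int H..int H} = 2 * H + 1" by simp
    then show ?thesis unfolding B_def using V(1) by (simp only: card_PiE prod_constant)
  qed
  also have "\<dots> \<le> (2 * H + 1) ^ D" using V(3) by (intro power_increasing) auto
  \<comment> \<open>\<open>X\<close> is the \<open>D\<close>-th power of
    \<open>2 * Suc D * h ^ D + 1\<close>, so this bound for the number of coordinate vectors
    collapses to \<open>X ^ Suc D\<close>, which is less than the number
    \<open>(X + 1) ^ Suc D\<close> of coefficient vectors.\<close>
  also have "\<dots> \<le> ((2 * Suc D * h ^ D + 1) * X) ^ D"
  proof (intro power_mono)
    have "X \<ge> 1" unfolding X_def by (simp del: mult_Suc)
    then show "2 * H + 1 \<le> (2 * Suc D * h ^ D + 1) * X"
      by (simp add: H_def algebra_simps)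
  qed simp
  also have "\<dots> = X ^ Suc D" by (simp add: X_def power_mult_distrib del: mult_Suc)
  also have "\<dots> < (X + 1) ^ Suc D" by (intro power_strict_mono) auto
  also have "\<dots> = card A"
  proof -
    have "card {0..int X} = X + 1" by simp
    then show ?thesis unfolding A_def by (simp only: card_PiE finite_atMost prod_constant card_atMost)
  qed
  finally have "card (F ` A) < card A" using card_mono[OF finB F] by linarith
  then have "\<not> inj_on F A" using pigeonhole by blast
  then obtain a a' where a: "a \<in> A" "a' \<in> A" "F a = F a'" "a \<noteq> a'" unfolding inj_on_def by blast
  let ?b = "\<lambda>k. if k \<le> D then a k - a' k else 0"
  have "\<exists>k\<le>D. ?b k \<noteq> 0"
    using a(1,2,4) unfolding A_def by (metis PiE_ext atMost_iff eq_iff_diff_eq_0)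
  moreover have "\<forall>k. \<bar>?b k\<bar> \<le> int X"
  proof
    fix k
    show "\<bar>?b k\<bar> \<le> int X"
    proof (cases "k \<le> D")
      case True
      then have "0 \<le> a k" "a k \<le> int X" "0 \<le> a' k" "a' k \<le> int X"
        using a(1,2) by (auto simp: A_def PiE_def Pi_def)
      then show ?thesis using True by simp
    qed simp
  qed
  moreover have "(\<Sum>k\<le>D. of_int (?b k) * l ^ k) = 0"
  proof -
    have "(\<Sum>k\<le>D. of_int (?b k) * l ^ k) = (\<Sum>k\<le>D. \<Sum>y\<in>V. of_int ((a k - a' k) * m k y) * y)"
      by (intro sum.cong refl) (simp add: m(2) sum_distrib_left mult.assoc)
    also have "\<dots> = (\<Sum>y\<in>V. of_int (\<Sum>k\<le>D. (a k - a' k) * m k y) * y)"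
      by (subst sum.swap) (simp add: sum_distrib_right)
    also have "\<dots> = 0"
    proof (intro sum.neutral ballI)
      fix y assume "y \<in> V"
      then have "(\<Sum>k\<le>D. a k * m k y) = (\<Sum>k\<le>D. a' k * m k y)"
        using fun_cong[OF a(3), of y] by (simp add: F_def)
      then have "(\<Sum>k\<le>D. (a k - a' k) * m k y) = 0"
        by (simp add: left_diff_distrib sum_subtractf)
      then show "of_int (\<Sum>k\<le>D. (a k - a' k) * m k y) * y = 0" by simp
    qed
    finally show ?thesis .
  qed
  ultimately show ?thesis by (intro exI[of _ ?b] conjI)
qed

text \<open>After division by the lowest power of \<open>l\<close> that occurs, a nonzero integer is
  balanced by the higher terms; if \<open>cmod l < 1\<close>, each of these is at most
  \<open>cmod l * X\<close> in modulus.\<close>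

lemma nonzero_root_lower_bound:
  fixes b :: "nat \<Rightarrow> int" and l :: complex
  assumes b: "\<exists>k\<le>D. b k \<noteq> 0" "\<forall>k. \<bar>b k\<bar> \<le> int X" and root: "(\<Sum>k\<le>D. of_int (b k) * l ^ k) = 0"
    and l: "l \<noteq> 0"
  shows "1 \<le> cmod l * (real (Suc D * X))"
proof -
  define k where "k = (LEAST k. b k \<noteq> 0)"
  obtain j where j: "j \<le> D" "b j \<noteq> 0" using b(1) by blast
  have k: "b k \<noteq> 0" "k \<le> D"
    using LeastI[of "\<lambda>k. b k \<noteq> 0", OF j(2)] Least_le[of "\<lambda>k. b k \<noteq> 0", OF j(2)] j(1)
    by (auto simp: k_def)
  have less: "b i = 0" if "i < k" for i using not_less_Least that unfolding k_def by blast
  have X: "1 \<le> real (Suc D * X)"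
  proof -
    have "1 \<le> \<bar>b k\<bar>" using k by simp
    then have "1 \<le> X" using b(2)[rule_format, of k] by linarith
    then have "1 \<le> Suc D * X" by simp
    then show ?thesis by linarith
  qed
  show ?thesis
  proof (cases "cmod l \<ge> 1")
    case True
    then show ?thesis using X mult_mono[OF True X] by simp
  next
    case False
    have "(\<Sum>i\<le>D. of_int (b i) * l ^ i) = (\<Sum>i\<in>{k..D}. of_int (b i) * l ^ i)"
      using less by (intro sum.mono_neutral_right) (auto simp: not_le)
    also have "\<dots> = of_int (b k) * l ^ k + (\<Sum>i\<in>{Suc k..D}. of_int (b i) * l ^ i)"
      using k(2) by (simp add: sum.atLeast_Suc_atMost)
    also have "(\<Sum>i\<in>{Suc k..D}. of_int (b i) * l ^ i) = l ^ k * (\<Sum>i\<in>{Suc k..D}. of_int (b i) * l ^ (i - k))"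
      unfolding sum_distrib_left
      by (intro sum.cong refl) (simp add: mult_ac flip: power_add)
    finally have "l ^ k * (of_int (b k) + (\<Sum>i\<in>{Suc k..D}. of_int (b i) * l ^ (i - k))) = 0"
      using root by (simp add: algebra_simps)
    then have "of_int (b k) = - (\<Sum>i\<in>{Suc k..D}. of_int (b i) * l ^ (i - k))"
      using l by (simp add: eq_neg_iff_add_eq_0)
    moreover have "1 \<le> cmod (of_int (b k))" using k(1) by simp
    ultimately have "1 \<le> cmod (\<Sum>i\<in>{Suc k..D}. of_int (b i) * l ^ (i - k))" by simp
    also have "\<dots> \<le> (\<Sum>i\<in>{Suc k..D}. cmod l * real X)"
    proof (intro sum_norm_le)
      fix i assume "i \<in> {Suc k..D}"
      then have "cmod l ^ (i - k) \<le> cmod l ^ 1" using False by (intro power_decreasing) auto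
      moreover have "\<bar>real_of_int (b i)\<bar> \<le> real X" using b(2)[rule_format, of i] by linarith
      ultimately show "cmod (of_int (b i) * l ^ (i - k)) \<le> cmod l * real X"
        by (simp add: norm_mult norm_power mult.commute mult_mono)
    qed
    also have "\<dots> \<le> real (Suc D) * (cmod l * real X)"
      by (simp add: mult_right_mono)
    finally show ?thesis by (simp add: algebra_simps)
  qed
qed

text \<open>The root bound applies to \<open>c * z\<close>, which preserves the lattice;
  \<open>c \<le> h\<close> accounts for the extra factor \<open>h\<close>.\<close>

lemma stabilized_lower_bound:
  assumes V: "finite V" "1 \<in> V" "card V \<le> D" and z: "stabilized V h z" "z \<noteq> 0"
  shows "1 \<le> cmod z * real (h * (Suc D * (2 * Suc D * h ^ D + 1) ^ D))"
proof -
  obtain c where h: "1 \<le> c" "c \<le> h" "stabilizes V h c z" using z(1) unfolding stabilized_def by blast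
  let ?X = "(2 * Suc D * h ^ D + 1) ^ D"
  obtain b :: "nat \<Rightarrow> int" where "\<exists>k\<le>D. b k \<noteq> 0" "\<forall>k. \<bar>b k\<bar> \<le> int ?X"
    "(\<Sum>k\<le>D. of_int (b k) * (of_nat c * z) ^ k) = 0"
    using pigeonhole_relation[OF V, of h "of_nat c * z"] h by (auto simp: stabilizes_def)
  then have "1 \<le> cmod (of_nat c * z) * real (Suc D * ?X)"
    using h(1) z(2) by (intro nonzero_root_lower_bound) auto
  also have "\<dots> = cmod z * (real c * real (Suc D * ?X))" by (simp add: norm_mult del: mult_Suc)
  also have "\<dots> \<le> cmod z * (real h * real (Suc D * ?X))"
    using h by (intro mult_left_mono mult_right_mono) auto
  finally show ?thesis by (simp only: of_nat_mult)
qed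

section \<open>Polynomial functions of eight numbers and their conjugates\<close>

text \<open>Each closure property becomes a case of the inductions below. There is no clause for
  constants; integer multiples are written as repeated sums, as in \<open>D + D + D + D\<close>
  later on.\<close>

inductive polyfun :: "((nat \<Rightarrow> complex) \<Rightarrow> complex) \<Rightarrow> bool" where
  var: "i < 8 \<Longrightarrow> polyfun (\<lambda>\<rho>. \<rho> i)"
| add: "polyfun f \<Longrightarrow> polyfun g \<Longrightarrow> polyfun (\<lambda>\<rho>. f \<rho> + g \<rho>)"
| uminus: "polyfun f \<Longrightarrow> polyfun (\<lambda>\<rho>. - f \<rho>)"
| mult: "polyfun f \<Longrightarrow> polyfun g \<Longrightarrow> polyfun (\<lambda>\<rho>. f \<rho> * g \<rho>)"
| cnj: "polyfun f \<Longrightarrow> polyfun (\<lambda>\<rho>. cnj (f \<rho>))"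

lemma polyfun_diff: "polyfun f \<Longrightarrow> polyfun g \<Longrightarrow> polyfun (\<lambda>\<rho>. f \<rho> - g \<rho>)"
  using polyfun.add[OF _ polyfun.uminus] by simp

lemma polyfun_gauss_fun:
  assumes "polyfun f" "\<And>i. i < 8 \<Longrightarrow> gauss_fun (\<lambda>n. \<rho> n i)"
  shows "gauss_fun (\<lambda>n. f (\<rho> n))"
  using assms
  by (induction rule: polyfun.induct)
    (auto intro: gauss_fun_add gauss_fun_uminus gauss_fun_mult gauss_fun_cnj)

text \<open>\<open>L n\<close> is both a bound for the values and a Lipschitz constant, since the
  estimate for products needs both. The restriction \<open>\<delta> \<le> 1\<close> absorbs the
  quadratic term.\<close>

definition perturbation_bound :: "(nat \<Rightarrow> nat) \<Rightarrow> ((nat \<Rightarrow> complex) \<Rightarrow> complex) \<Rightarrow> bool" where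
  "perturbation_bound L f \<longleftrightarrow> (\<forall>n \<rho> \<rho>' \<delta>. 0 \<le> \<delta> \<longrightarrow> \<delta> \<le> 1 \<longrightarrow>
     (\<forall>i<8. cmod (\<rho> i) \<le> real n \<and> cmod (\<rho>' i - \<rho> i) \<le> \<delta>) \<longrightarrow>
     cmod (f \<rho>) \<le> real (L n) \<and> cmod (f \<rho>' - f \<rho>) \<le> real (L n) * \<delta>)"

lemma perturbation_boundD:
  assumes "perturbation_bound L f" "0 \<le> \<delta>" "\<delta> \<le> 1"
    "\<forall>i<8. cmod (\<rho> i) \<le> real n \<and> cmod (\<rho>' i - \<rho> i) \<le> \<delta>"
  shows "cmod (f \<rho>) \<le> real (L n)" "cmod (f \<rho>' - f \<rho>) \<le> real (L n) * \<delta>"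
  using assms unfolding perturbation_bound_def by blast+

lemma perturbation_bound_add:
  assumes f: "perturbation_bound L f" and g: "perturbation_bound M g"
  shows "perturbation_bound (\<lambda>n. L n + M n) (\<lambda>\<rho>. f \<rho> + g \<rho>)"
  unfolding perturbation_bound_def
proof (intro conjI allI impI)
  fix n and \<rho> \<rho>' :: "nat \<Rightarrow> complex" and \<delta> :: real
  assume "0 \<le> \<delta>" "\<delta> \<le> 1" "\<forall>i<8. cmod (\<rho> i) \<le> real n \<and> cmod (\<rho>' i - \<rho> i) \<le> \<delta>"
  note f = perturbation_boundD[OF f this] and g = perturbation_boundD[OF g this]
  show "cmod (f \<rho> + g \<rho>) \<le> real (L n + M n)"
    using f g norm_triangle_ineq[of "f \<rho>" "g \<rho>"] by simp
  show "cmod (f \<rho>' + g \<rho>' - (f \<rho> + g \<rho>)) \<le> real (L n + M n) * \<delta>"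
    using f g norm_diff_triangle_ineq[of "f \<rho>'" "g \<rho>'" "f \<rho>" "g \<rho>"]
    by (simp add: distrib_right)
qed

text \<open>The change of a product splits into three terms, each at most
  \<open>L n * M n * \<delta>\<close>; hence the factor 3.\<close>

lemma perturbation_bound_mult:
  assumes f: "perturbation_bound L f" and g: "perturbation_bound M g"
  shows "perturbation_bound (\<lambda>n. 3 * (L n * M n)) (\<lambda>\<rho>. f \<rho> * g \<rho>)"
  unfolding perturbation_bound_def
proof (intro conjI allI impI)
  fix n and \<rho> \<rho>' :: "nat \<Rightarrow> complex" and \<delta> :: real
  assume b: "0 \<le> \<delta>" "\<delta> \<le> 1" "\<forall>i<8. cmod (\<rho> i) \<le> real n \<and> cmod (\<rho>' i - \<rho> i) \<le> \<delta>"
  note f = perturbation_boundD[OF f b] and g = perturbation_boundD[OF g b]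
  have "cmod (f \<rho> * g \<rho>) \<le> real (L n) * real (M n)"
    unfolding norm_mult using f g by (intro mult_mono) auto
  moreover have "0 \<le> real (L n) * real (M n)" by simp
  ultimately show "cmod (f \<rho> * g \<rho>) \<le> real (3 * (L n * M n))"
    unfolding of_nat_mult of_nat_numeral by linarith
  have "f \<rho>' * g \<rho>' - f \<rho> * g \<rho>
      = ((f \<rho>' - f \<rho>) * (g \<rho>' - g \<rho>) + (f \<rho>' - f \<rho>) * g \<rho>) + f \<rho> * (g \<rho>' - g \<rho>)"
    by (simp add: algebra_simps)
  also have "cmod \<dots> \<le> (cmod (f \<rho>' - f \<rho>) * cmod (g \<rho>' - g \<rho>) + cmod (f \<rho>' - f \<rho>) * cmod (g \<rho>))
      + cmod (f \<rho>) * cmod (g \<rho>' - g \<rho>)"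
    unfolding norm_mult[symmetric]
    by (intro order.trans[OF norm_triangle_ineq] add_mono norm_triangle_ineq order.refl)
  also have "\<dots> \<le> ((real (L n) * \<delta>) * real (M n) + (real (L n) * \<delta>) * real (M n))
      + real (L n) * (real (M n) * \<delta>)"
  proof (intro add_mono mult_mono)
    have "real (M n) * \<delta> \<le> real (M n) * 1" using b by (intro mult_left_mono) auto
    then show "cmod (g \<rho>' - g \<rho>) \<le> real (M n)" using g by linarith
  qed (use f g b in auto)
  also have "\<dots> = real (3 * (L n * M n)) * \<delta>" by simp
  finally show "cmod (f \<rho>' * g \<rho>' - f \<rho> * g \<rho>) \<le> real (3 * (L n * M n)) * \<delta>" .
qed

lemma polyfun_perturbation:
  "polyfun f \<Longrightarrow> \<exists>L. computable L \<and> perturbation_bound L f"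
proof (induction rule: polyfun.induct)
  case (var i)
  show ?case
  \<comment> \<open>\<open>Suc n\<close> dominates both the value bound \<open>n\<close> and the
    Lipschitz constant 1.\<close>
  proof (intro exI[of _ Suc] conjI)
    show "computable Suc" by (rule computable_Suc[OF computable_id])
    show "perturbation_bound Suc (\<lambda>\<rho>. \<rho> i)"
      unfolding perturbation_bound_def
    proof (intro conjI allI impI)
      fix n and \<rho> \<rho>' :: "nat \<Rightarrow> complex" and \<delta> :: real
      assume \<delta>: "0 \<le> \<delta>" and b: "\<forall>i<8. cmod (\<rho> i) \<le> real n \<and> cmod (\<rho>' i - \<rho> i) \<le> \<delta>"
      have *: "cmod (\<rho> i) \<le> real n" "cmod (\<rho>' i - \<rho> i) \<le> \<delta>" using b var by auto
      show "cmod (\<rho> i) \<le> real (Suc n)" using * by simp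
      have "0 \<le> real n * \<delta>" using \<delta> by simp
      then show "cmod (\<rho>' i - \<rho> i) \<le> real (Suc n) * \<delta>" using * by (simp add: algebra_simps)
    qed
  qed
next
  case (add f g)
  then show ?case using computable_add perturbation_bound_add by blast
next
  case (uminus f)
  then obtain L where "computable L" "perturbation_bound L f" by blast
  moreover have "cmod (- f \<rho>' - - f \<rho>) = cmod (f \<rho>' - f \<rho>)" for \<rho> \<rho>'
    using norm_minus_cancel[of "f \<rho>' - f \<rho>"] by simp
  ultimately have "computable L \<and> perturbation_bound L (\<lambda>\<rho>. - f \<rho>)"
    unfolding perturbation_bound_def norm_minus_cancel by metis
  then show ?case by (intro exI[of _ L])
next
  case (mult f g)
  then obtain L M where "computable L" "perturbation_bound L f" "computable M" "perturbation_bound M g"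
    by blast
  then show ?case
    by (intro exI[of _ "\<lambda>n. 3 * (L n * M n)"] conjI computable_mult computable_const
        perturbation_bound_mult)
next
  case (cnj f)
  then show ?case unfolding perturbation_bound_def by (simp flip: complex_cnj_diff)
qed

text \<open>The conjugate value is carried along because a lattice stable under \<open>z\<close> may
  fail to be stable under \<open>cnj z\<close>; the case of conjugation then merely exchanges the
  two claims. Since \<open>h\<close> depends on \<open>f\<close> alone, it can be built into the
  program.\<close>

lemma polyfun_stabilized:
  "polyfun f \<Longrightarrow> \<exists>h. computable h \<and> (\<forall>s V \<rho>.
     (\<forall>i<8. stabilized V s (\<rho> i) \<and> stabilized V s (cnj (\<rho> i))) \<longrightarrow>
     stabilized V (h s) (f \<rho>) \<and> stabilized V (h s) (cnj (f \<rho>)))"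
proof (induction rule: polyfun.induct)
  case (var i)
  then show ?case by (intro exI[of _ "\<lambda>s. s"]) (auto intro: computable_id)
next
  case (add f g)
  then obtain h k where h: "computable h" "\<forall>s V \<rho>.
     (\<forall>i<8. stabilized V s (\<rho> i) \<and> stabilized V s (cnj (\<rho> i))) \<longrightarrow>
     stabilized V (h s) (f \<rho>) \<and> stabilized V (h s) (cnj (f \<rho>))"
    and k: "computable k" "\<forall>s V \<rho>.
     (\<forall>i<8. stabilized V s (\<rho> i) \<and> stabilized V s (cnj (\<rho> i))) \<longrightarrow>
     stabilized V (k s) (g \<rho>) \<and> stabilized V (k s) (cnj (g \<rho>))" by blast
  show ?case
    by (intro exI[of _ "\<lambda>s. 2 * (h s * k s)"])
      (use h(2) k(2) in \<open>auto intro!: computable_mult computable_const h(1) k(1) stabilized_add\<close>)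
next
  case (uminus f)
  then show ?case by (metis complex_cnj_minus stabilized_uminus)
next
  case (mult f g)
  then obtain h k where h: "computable h" "\<forall>s V \<rho>.
     (\<forall>i<8. stabilized V s (\<rho> i) \<and> stabilized V s (cnj (\<rho> i))) \<longrightarrow>
     stabilized V (h s) (f \<rho>) \<and> stabilized V (h s) (cnj (f \<rho>))"
    and k: "computable k" "\<forall>s V \<rho>.
     (\<forall>i<8. stabilized V s (\<rho> i) \<and> stabilized V s (cnj (\<rho> i))) \<longrightarrow>
     stabilized V (k s) (g \<rho>) \<and> stabilized V (k s) (cnj (g \<rho>))" by blast
  show ?case
    by (intro exI[of _ "\<lambda>s. h s * k s"])
      (use h(2) k(2) in \<open>auto intro!: computable_mult h(1) k(1) stabilized_mult\<close>)
next
  case (cnj f)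
  then show ?case by (metis complex_cnj_cnj)
qed

text \<open>The exponent 16 in the proof counts the eight numbers and their eight conjugates, each
  of which multiplies the size of the generating set by at most \<open>n\<close>.\<close>

lemma polyfun_lower_bound:
  assumes "polyfun f"
  shows "\<exists>B. computable B \<and> (\<forall>n \<rho>. (\<forall>i<8. poly_bounded n (n * n) (\<rho> i)) \<longrightarrow> f \<rho> \<noteq> 0 \<longrightarrow>
    1 \<le> cmod (f \<rho>) * real (B n))"
proof -
  obtain h where h: "computable h" "\<forall>s V \<rho>.
     (\<forall>i<8. stabilized V s (\<rho> i) \<and> stabilized V s (cnj (\<rho> i))) \<longrightarrow>
     stabilized V (h s) (f \<rho>) \<and> stabilized V (h s) (cnj (f \<rho>))"
    using polyfun_stabilized[OF assms] by blast
  define B where "B n = h (n * n) * (Suc (n ^ 16) * (2 * Suc (n ^ 16) * h (n * n) ^ (n ^ 16) + 1) ^ (n ^ 16))" for n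
  have hn: "computable (\<lambda>n. h (n * n))"
    by (intro computable_compose[OF h(1)] computable_mult computable_id)
  have "computable B" unfolding B_def
    by (intro computable_mult computable_power computable_add computable_Suc computable_const
        computable_id hn)
  moreover have "1 \<le> cmod (f \<rho>) * real (B n)"
    if \<rho>: "\<forall>i<8. poly_bounded n (n * n) (\<rho> i)" and nz: "f \<rho> \<noteq> 0" for n \<rho>
  proof -
    let ?zs = "map \<rho> [0..<8] @ map (\<lambda>i. cnj (\<rho> i)) [0..<8]"
    have "poly_bounded n (n * n) z" if "z \<in> set ?zs" for z
      using that \<rho> by (auto intro: poly_bounded_cnj)
    from common_stabilizer[of ?zs, OF this] obtain V where
      V: "finite V" "1 \<in> V" "card V \<le> n ^ length ?zs" "\<forall>z\<in>set ?zs. stabilized V (n * n) z"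
      by blast
    have card: "card V \<le> n ^ 16" using V(3) by simp
    have "stabilized V (h (n * n)) (f \<rho>)"
      using h(2) V(4) by simp
    from stabilized_lower_bound[OF V(1,2) card this nz] show ?thesis
      unfolding B_def .
  qed
  ultimately show ?thesis by blast
qed

section \<open>Zeros of planar linear flows\<close>

definition area :: "complex^2 \<Rightarrow> complex^2 \<Rightarrow> complex" where
  "area u x = u $ 1 * x $ 2 - u $ 2 * x $ 1"

lemma span_singleton_iff_area:
  assumes "u \<noteq> 0" shows "x \<in> vec.span {u} \<longleftrightarrow> area u x = 0"
proof
  assume "x \<in> vec.span {u}"
  then obtain k where "x = k *s u" by (auto simp: vec.span_singleton)
  then show "area u x = 0" by (simp add: area_def)
next
  assume eq: "area u x = 0"
  have "\<exists>k. x = k *s u"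
  proof (cases "u $ 1 = 0")
    case True
    then have u2: "u $ 2 \<noteq> 0" using assms by (auto simp: vec_eq_iff forall_2)
    then have "x = (x $ 2 / u $ 2) *s u" using True eq by (auto simp: area_def vec_eq_iff forall_2)
    then show ?thesis ..
  next
    case False
    then have "x = (x $ 1 / u $ 1) *s u"
      using eq by (auto simp: area_def vec_eq_iff forall_2 field_simps)
    then show ?thesis ..
  qed
  then show "x \<in> vec.span {u}" by (auto simp: vec.span_singleton)
qed

lemma bounded_linear_area: "bounded_linear (area u)"
  unfolding area_def
  by (intro bounded_linear_sub bounded_linear_compose[OF bounded_linear_mult_right]
      bounded_linear_vec_nth)

lemma cayley_hamilton_2:
  fixes A :: "complex^2^2"
  assumes "l1 + l2 = A $ 1 $ 1 + A $ 2 $ 2" "l1 * l2 = A $ 1 $ 1 * A $ 2 $ 2 - A $ 1 $ 2 * A $ 2 $ 1"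
  shows "area u (A *v (A *v x)) = (l1 + l2) * area u (A *v x) - l1 * l2 * area u x"
  unfolding assms by (simp add: area_def matrix_vector_mult_def sum_2 algebra_simps)

section \<open>Closed forms of the area along the flow\<close>

lemma exponential_unique:
  fixes p :: "real \<Rightarrow> complex"
  assumes "\<And>t. (p has_vector_derivative l * p t) (at t)"
  shows "p t = p 0 * exp (l * of_real t)"
proof -
  have "((\<lambda>t. p t * exp (- l * of_real t)) has_vector_derivative 0) (at t)" for t
    by (rule has_vector_derivative_eq_rhs, (rule derivative_intros assms has_vector_derivative_real_field)+)
      (auto intro!: derivative_eq_intros)
  then have "(\<lambda>t. p t * exp (- l * of_real t)) t = (\<lambda>t. p t * exp (- l * of_real t)) 0"
    by (intro has_derivative_zero_unique[of UNIV]) (auto simp: has_vector_derivative_def)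
  then show ?thesis by (simp add: exp_minus field_simps)
qed

lemma area_flow_derivative:
  fixes A :: "complex^2^2" shows "((\<lambda>t. area u (flow A x t)) has_vector_derivative area u (A *v flow A x t)) (at t)"
  by (rule bounded_linear.has_vector_derivative[OF bounded_linear_area flow_has_vector_derivative])

lemma area_flow_derivative2:
  fixes A :: "complex^2^2" shows "((\<lambda>t. area u (A *v flow A x t)) has_vector_derivative area u (A *v (A *v flow A x t))) (at t)"
proof -
  have "bounded_linear (\<lambda>y :: complex^2. area u (A *v y))"
    by (intro bounded_linear_compose[OF bounded_linear_area] linear_conv_bounded_linear[THEN iffD1] linearI)
      (auto simp: matrix_vector_mult_def vec_eq_iff algebra_simps sum.distrib scaleR_sum_right)
  then show ?thesis
    by (rule bounded_linear.has_vector_derivative[OF _ flow_has_vector_derivative])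
qed

text \<open>By Cayley-Hamilton the second order equation for the area factors into
  \<open>d/dt - l1\<close> and \<open>d/dt - l2\<close>; applying the latter leaves a solution of
  \<open>p' = l1 * p\<close>.\<close>

lemma area_flow_first_order:
  fixes A :: "complex^2^2"
  assumes sum: "l1 + l2 = A $ 1 $ 1 + A $ 2 $ 2"
    and prod: "l1 * l2 = A $ 1 $ 1 * A $ 2 $ 2 - A $ 1 $ 2 * A $ 2 $ 1"
  shows "area u (A *v flow A x t) - l2 * area u (flow A x t)
    = (area u (A *v x) - l2 * area u x) * exp (l1 * of_real t)"
proof -
  let ?p = "\<lambda>t. area u (A *v flow A x t) - l2 * area u (flow A x t)"
  have "(?p has_vector_derivative l1 * ?p t) (at t)" for t
    by (rule has_vector_derivative_eq_rhs, (rule derivative_intros area_flow_derivative area_flow_derivative2)+)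
      (simp add: cayley_hamilton_2[OF sum prod] algebra_simps)
  from exponential_unique[of ?p, OF this] show ?thesis by (simp add: flow_0)
qed

text \<open>Exchanging the roots in the first order identity and subtracting eliminates the
  derivative.\<close>

lemma area_flow_distinct:
  fixes A :: "complex^2^2"
  assumes "l1 + l2 = A $ 1 $ 1 + A $ 2 $ 2"
    and "l1 * l2 = A $ 1 $ 1 * A $ 2 $ 2 - A $ 1 $ 2 * A $ 2 $ 1"
  shows "(l1 - l2) * area u (flow A x t)
    = (area u (A *v x) - l2 * area u x) * exp (l1 * of_real t)
      - (area u (A *v x) - l1 * area u x) * exp (l2 * of_real t)"
proof -
  have "(l1 - l2) * area u (flow A x t)
    = (area u (A *v flow A x t) - l2 * area u (flow A x t))
      - (area u (A *v flow A x t) - l1 * area u (flow A x t))" by (simp add: algebra_simps)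
  then show ?thesis
    using area_flow_first_order[OF assms] area_flow_first_order[of l2 l1 A u x t] assms
    by (simp only: add.commute[of l2 l1] mult.commute[of l2 l1])
qed

text \<open>For a double root, the area times \<open>exp (- l * t)\<close> has a constant derivative
  and is therefore affine in \<open>t\<close>.\<close>

lemma area_flow_double:
  fixes A :: "complex^2^2"
  assumes "l + l = A $ 1 $ 1 + A $ 2 $ 2"
    and "l * l = A $ 1 $ 1 * A $ 2 $ 2 - A $ 1 $ 2 * A $ 2 $ 1"
  shows "area u (flow A x t) = (area u x + (area u (A *v x) - l * area u x) * of_real t) * exp (l * of_real t)"
proof -
  define p where "p = area u (A *v x) - l * area u x"
  let ?h = "\<lambda>t. area u (flow A x t) * exp (- l * of_real t) - p * of_real t"
  have "(?h has_vector_derivative 0) (at t)" for t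
  proof -
    have "((\<lambda>t. exp (- l * of_real t)) has_vector_derivative - l * exp (- l * of_real t)) (at t)"
      by (intro has_vector_derivative_real_field) (auto intro!: derivative_eq_intros)
    moreover have "((\<lambda>t. p * of_real t) has_vector_derivative p) (at t)"
      by (intro has_vector_derivative_real_field) (auto intro!: derivative_eq_intros)
    ultimately have "(?h has_vector_derivative (area u (flow A x t) * (- l * exp (- l * of_real t))
        + area u (A *v flow A x t) * exp (- l * of_real t)) - p) (at t)"
      by (intro has_vector_derivative_diff has_vector_derivative_mult area_flow_derivative)
    moreover have "area u (A *v flow A x t) = p * exp (l * of_real t) + l * area u (flow A x t)"
      using area_flow_first_order[OF assms, of u x t] by (simp add: p_def algebra_simps)
    ultimately show ?thesis by (simp add: algebra_simps exp_minus)
  qed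
  then have "?h t = ?h 0"
    by (intro has_derivative_zero_unique[of UNIV ?h]) (auto simp: has_vector_derivative_def)
  then show ?thesis by (simp add: flow_0 p_def[symmetric] exp_minus field_simps)
qed

section \<open>Eigenvalues and the criterion for a positive zero\<close>

lemma characteristic_root_eigenvalue:
  fixes A :: "complex^2^2"
  assumes "l1 + l2 = A $ 1 $ 1 + A $ 2 $ 2"
    and "l1 * l2 = A $ 1 $ 1 * A $ 2 $ 2 - A $ 1 $ 2 * A $ 2 $ 1"
  shows "eigenvalue A l1"
proof -
  have l2: "l2 = A $ 1 $ 1 + A $ 2 $ 2 - l1" using assms(1) by (simp add: algebra_simps)
  have char: "(l1 - A $ 1 $ 1) * (l1 - A $ 2 $ 2) = A $ 1 $ 2 * A $ 2 $ 1"
    using assms(2) unfolding l2 by (simp add: algebra_simps)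
  have "\<exists>a b. (a \<noteq> 0 \<or> b \<noteq> 0) \<and> A $ 1 $ 1 * a + A $ 1 $ 2 * b = l1 * a \<and>
      A $ 2 $ 1 * a + A $ 2 $ 2 * b = l1 * b"
  \<comment> \<open>A nonzero row of \<open>A - l1\<close> is annihilated by the vector with its
    entries exchanged and one sign changed; singularity takes care of the other row. If both rows
    vanish, any vector will do.\<close>
  proof (cases "A $ 1 $ 2 = 0 \<and> l1 = A $ 1 $ 1")
    case False
    then show ?thesis using char
      by (intro exI[of _ "A $ 1 $ 2"] exI[of _ "l1 - A $ 1 $ 1"]) (auto simp: algebra_simps)
  next
    case True
    show ?thesis
    proof (cases "A $ 2 $ 1 = 0 \<and> l1 = A $ 2 $ 2")
      case False
      then show ?thesis using char True
        by (intro exI[of _ "l1 - A $ 2 $ 2"] exI[of _ "A $ 2 $ 1"]) (auto simp: algebra_simps)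
    next
      case True': True
      show ?thesis using True True' by (intro exI[of _ 1] exI[of _ 0]) auto
    qed
  qed
  then obtain a b where ab: "a \<noteq> 0 \<or> b \<noteq> 0" "A $ 1 $ 1 * a + A $ 1 $ 2 * b = l1 * a"
    "A $ 2 $ 1 * a + A $ 2 $ 2 * b = l1 * b" by blast
  show ?thesis unfolding eigenvalue_def
    using ab by (intro exI[of _ "vector [a, b]"])
      (auto simp: vec_eq_iff forall_2 matrix_vector_mult_def sum_2)
qed

lemma characteristic_roots_exist:
  fixes A :: "complex^2^2"
  obtains l1 l2 where "l1 + l2 = A $ 1 $ 1 + A $ 2 $ 2"
    "l1 * l2 = A $ 1 $ 1 * A $ 2 $ 2 - A $ 1 $ 2 * A $ 2 $ 1"
proof
  define T D where "T = A $ 1 $ 1 + A $ 2 $ 2" and "D = A $ 1 $ 1 * A $ 2 $ 2 - A $ 1 $ 2 * A $ 2 $ 1"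
  let ?s = "csqrt (T\<^sup>2 - 4 * D)"
  show "(T + ?s) / 2 + (T - ?s) / 2 = A $ 1 $ 1 + A $ 2 $ 2" by (simp add: T_def field_simps)
  have "(T + ?s) / 2 * ((T - ?s) / 2) = (T\<^sup>2 - ?s\<^sup>2) / 4" by (simp add: field_simps power2_eq_square)
  also have "\<dots> = D" by simp
  finally show "(T + ?s) / 2 * ((T - ?s) / 2) = A $ 1 $ 1 * A $ 2 $ 2 - A $ 1 $ 2 * A $ 2 $ 1"
    by (simp add: D_def)
qed

text \<open>For \<open>a \<noteq> 0\<close> the product \<open>a * cnj c\<close> is
  \<open>(cmod a)\<^sup>2\<close> times the conjugate of \<open>c / a\<close>, so it is a negative
  real exactly if \<open>c / a\<close> is. This replaces the quotient by a polynomial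
  expression.\<close>

lemma negative_multiple_iff:
  fixes a c :: complex
  shows "Im (a * cnj c) = 0 \<and> Re (a * cnj c) < 0 \<longleftrightarrow> a \<noteq> 0 \<and> (\<exists>k>0. c = - of_real k * a)"
proof
  assume *: "Im (a * cnj c) = 0 \<and> Re (a * cnj c) < 0"
  then have a: "a \<noteq> 0" by auto
  define k where "k = - Re (a * cnj c) / (cmod a)\<^sup>2"
  have "k > 0" using * a by (simp add: k_def divide_neg_pos)
  have "a * cnj c = of_real (Re (a * cnj c))" using * by (simp add: complex_eq_iff)
  also have "\<dots> = - of_real k * (a * cnj a)"
    using a by (simp add: k_def complex_norm_square[symmetric] flip: of_real_power)
  finally have "a * (cnj c + of_real k * cnj a) = 0" by (simp add: algebra_simps)
  then have "cnj c = - of_real k * cnj a" using a by (simp add: eq_neg_iff_add_eq_0)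
  then have "c = - of_real k * a" by (metis complex_cnj_cnj complex_cnj_complex_of_real complex_cnj_minus complex_cnj_mult)
  with \<open>k > 0\<close> a show "a \<noteq> 0 \<and> (\<exists>k>0. c = - of_real k * a)" by blast
next
  assume "a \<noteq> 0 \<and> (\<exists>k>0. c = - of_real k * a)"
  then obtain k where k: "a \<noteq> 0" "k > 0" "c = - of_real k * a" by blast
  have "a * cnj c = - of_real (k * (cmod a)\<^sup>2)"
    unfolding k(3) by (simp add: complex_norm_square mult_ac del: of_real_power)
  note eq = this
  have "Re (a * cnj c) = - (k * (cmod a)\<^sup>2)"
    by (simp only: eq uminus_complex.sel Re_complex_of_real)
  moreover have "Im (a * cnj c) = 0"
    by (simp only: eq uminus_complex.sel Im_complex_of_real minus_zero)
  moreover have "k * (cmod a)\<^sup>2 > 0" using k by simp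
  ultimately show "Im (a * cnj c) = 0 \<and> Re (a * cnj c) < 0" by linarith
qed

text \<open>With \<open>E = exp (s * t)\<close> the equation reads
  \<open>c * (E - 1) = - s * (E + 1) * a\<close>. Sending \<open>E\<close> to
  \<open>s * (E + 1) / (E - 1)\<close> is a bijection from the numbers above 1 onto those above
  \<open>s\<close>, and every \<open>E > 1\<close> is attained at some \<open>t > 0\<close>.\<close>

lemma two_exponentials_zero_iff:
  fixes a c :: complex and s :: real
  assumes s: "s > 0"
  shows "(\<exists>t>0. (c + of_real s * a) * of_real (exp (s * t)) = c - of_real s * a) \<longleftrightarrow>
    a = 0 \<and> c = 0 \<or> a \<noteq> 0 \<and> (\<exists>k>s. c = - of_real k * a)"
proof
  assume "\<exists>t>0. (c + of_real s * a) * of_real (exp (s * t)) = c - of_real s * a"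
  then obtain t where t: "t > 0" "(c + of_real s * a) * of_real (exp (s * t)) = c - of_real s * a" by blast
  define E where "E = exp (s * t)"
  have E: "E > 1" using s t by (simp add: E_def)
  have eq: "c * of_real (E - 1) = - of_real (s * (E + 1)) * a"
    using t(2) unfolding E_def[symmetric] by (simp add: algebra_simps)
  define k where "k = s * (E + 1) / (E - 1)"
  have "c = - of_real k * a"
    using E arg_cong[OF eq, of "\<lambda>z. z / of_real (E - 1)"] by (simp add: k_def del: of_real_diff of_real_add)
  moreover have "k > s" using E s by (simp add: k_def pos_less_divide_eq algebra_simps)
  ultimately show "a = 0 \<and> c = 0 \<or> a \<noteq> 0 \<and> (\<exists>k>s. c = - of_real k * a)" by auto
next
  assume "a = 0 \<and> c = 0 \<or> a \<noteq> 0 \<and> (\<exists>k>s. c = - of_real k * a)"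
  then show "\<exists>t>0. (c + of_real s * a) * of_real (exp (s * t)) = c - of_real s * a"
  proof
    assume "a = 0 \<and> c = 0"
    then show ?thesis by (auto intro: exI[of _ 1])
  next
    assume "a \<noteq> 0 \<and> (\<exists>k>s. c = - of_real k * a)"
    then obtain k where k: "k > s" "c = - of_real k * a" by blast
    \<comment> \<open>The solution of \<open>k = s * (E + 1) / (E - 1)\<close>.\<close>
    define E where "E = (k + s) / (k - s)"
    have E: "E > 1" using k s by (simp add: E_def pos_less_divide_eq)
    have "(s - k) * E = - (k + s)" using k(1) by (simp add: E_def field_simps)
    then have "of_real ((s - k) * E) * a = of_real (- (k + s)) * a" by simp
    then have "(c + of_real s * a) * of_real E = c - of_real s * a"
      unfolding k(2) by (simp add: algebra_simps)
    moreover have "ln E / s > 0" "exp (s * (ln E / s)) = E" using E s by auto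
    ultimately show ?thesis by (metis)
  qed
qed

text \<open>The limiting case \<open>s = 0\<close> of the previous equivalence; here
  \<open>k = 2 / t\<close>.\<close>

lemma double_root_zero_iff:
  fixes a c :: complex
  shows "(\<exists>t>0. a + c / 2 * of_real t = 0) \<longleftrightarrow> a = 0 \<and> c = 0 \<or> a \<noteq> 0 \<and> (\<exists>k>0. c = - of_real k * a)"
proof
  assume "\<exists>t>0. a + c / 2 * of_real t = 0"
  then obtain t :: real where t: "t > 0" "a + c / 2 * of_real t = 0" by blast
  then have "c = - of_real (2 / t) * a" by (simp add: field_simps eq_neg_iff_add_eq_0)
  moreover from this have "a = 0 \<Longrightarrow> c = 0" by simp
  moreover have "2 / t > 0" using t by simp
  ultimately show "a = 0 \<and> c = 0 \<or> a \<noteq> 0 \<and> (\<exists>k>0. c = - of_real k * a)" by blast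
next
  assume "a = 0 \<and> c = 0 \<or> a \<noteq> 0 \<and> (\<exists>k>0. c = - of_real k * a)"
  then show "\<exists>t>0. a + c / 2 * of_real t = 0"
  proof
    assume "a = 0 \<and> c = 0"
    then show ?thesis by (auto intro: exI[of _ 1])
  next
    assume "a \<noteq> 0 \<and> (\<exists>k>0. c = - of_real k * a)"
    then obtain k where "k > 0" "c = - of_real k * a" by blast
    then show ?thesis by (intro exI[of _ "2 / k"]) simp
  qed
qed

text \<open>The eigenvalues \<open>m1 \<ge> m2\<close> get eliminated: \<open>k > m1 - m2\<close>
  becomes an inequality between squares, and \<open>(m1 - m2)\<^sup>2\<close> is the discriminant
  \<open>T * T - 4 * D\<close>.\<close>

lemma flow_meets_line_iff:
  fixes A :: "complex^2^2" and x u :: "complex^2"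
  assumes real: "\<forall>l. eigenvalue A l \<longrightarrow> l \<in> \<real>" and u: "u \<noteq> 0"
  defines "T \<equiv> A $ 1 $ 1 + A $ 2 $ 2" and "D \<equiv> A $ 1 $ 1 * A $ 2 $ 2 - A $ 1 $ 2 * A $ 2 $ 1"
    and "a \<equiv> area u x" and "b \<equiv> area u (A *v x)"
  defines "c \<equiv> b + b - T * a"
  shows "(\<exists>t>0. flow A x t \<in> vec.span {u}) \<longleftrightarrow>
    a = 0 \<and> b = 0 \<or> Im (a * cnj c) = 0 \<and> Re (a * cnj c) < 0 \<and>
      0 < Re (c * cnj c - (T * T - (D + D + D + D)) * (a * cnj a))"
proof -
  obtain z1 z2 where z: "z1 + z2 = T" "z1 * z2 = D"
    using characteristic_roots_exist[of A] unfolding T_def D_def by blast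
  have "z1 \<in> \<real>" "z2 \<in> \<real>"
    using characteristic_root_eigenvalue[of z1 z2 A] characteristic_root_eigenvalue[of z2 z1 A] z real
    by (auto simp: T_def D_def add.commute mult.commute)
  then obtain r1 r2 where r: "z1 = of_real r1" "z2 = of_real r2" by (auto elim!: Reals_cases)
  obtain m1 m2 where m: "of_real m1 + of_real m2 = T" "of_real m1 * of_real m2 = D" "m1 \<ge> m2"
    using z r by (metis add.commute linorder_linear mult.commute)
  note root = m(1,2)[unfolded T_def D_def]
  have Delta: "T * T - (D + D + D + D) = of_real ((m1 - m2)\<^sup>2)"
    unfolding m(1,2)[symmetric] by (simp add: algebra_simps power2_eq_square)
  have disc: "Re (c * cnj c - (T * T - (D + D + D + D)) * (a * cnj a)) = (cmod c)\<^sup>2 - (m1 - m2)\<^sup>2 * (cmod a)\<^sup>2"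
  proof -
    have norm: "z * cnj z = of_real ((cmod z)\<^sup>2)" for z by (simp only: complex_norm_square)
    show ?thesis unfolding Delta norm by (simp only: of_real_mult[symmetric] of_real_diff[symmetric] Re_complex_of_real)
  qed
  have crit: "(Im (a * cnj c) = 0 \<and> Re (a * cnj c) < 0 \<and>
      0 < Re (c * cnj c - (T * T - (D + D + D + D)) * (a * cnj a))) \<longleftrightarrow>
    a \<noteq> 0 \<and> (\<exists>k>m1 - m2. c = - of_real k * a)" (is "?L \<longleftrightarrow> ?R")
  proof -
    have "?L \<longleftrightarrow> (a \<noteq> 0 \<and> (\<exists>k>0. c = - of_real k * a)) \<and> (m1 - m2)\<^sup>2 * (cmod a)\<^sup>2 < (cmod c)\<^sup>2"
      unfolding disc negative_multiple_iff[symmetric] by auto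
    also have "\<dots> \<longleftrightarrow> ?R"
    proof -
      have "(m1 - m2)\<^sup>2 * (cmod a)\<^sup>2 < (cmod c)\<^sup>2 \<longleftrightarrow> m1 - m2 < k"
        if "k > 0" "c = - of_real k * a" "a \<noteq> 0" for k
      proof -
        have "(cmod c)\<^sup>2 = k\<^sup>2 * (cmod a)\<^sup>2" by (simp add: that norm_mult power_mult_distrib)
        then have "(m1 - m2)\<^sup>2 * (cmod a)\<^sup>2 < (cmod c)\<^sup>2 \<longleftrightarrow> (m1 - m2)\<^sup>2 < k\<^sup>2"
          using that(3) by simp
        also have "\<dots> \<longleftrightarrow> m1 - m2 < k"
          using m(3) that(1) by (metis diff_ge_0_iff_ge less_eq_real_def power2_less_imp_less power_strict_mono zero_less_numeral pos2)
        finally show ?thesis .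
      qed
      moreover have "k > 0" if "k > m1 - m2" for k using that m(3) by linarith
      ultimately show ?thesis by blast
    qed
    finally show ?thesis .
  qed
  have zero: "(\<exists>t>0. area u (flow A x t) = 0) \<longleftrightarrow> a = 0 \<and> c = 0 \<or> a \<noteq> 0 \<and> (\<exists>k>m1 - m2. c = - of_real k * a)"
  proof (cases "m1 = m2")
    case True
    have "c / 2 = area u (A *v x) - of_real m1 * area u x"
      unfolding c_def m(1)[symmetric] using True by (simp add: a_def b_def field_simps)
    then have "area u (flow A x t) = (a + c / 2 * of_real t) * exp (of_real m1 * of_real t)" for t
      using area_flow_double[of "of_real m1" A u x t] root True by (simp add: a_def)
    then show ?thesis using double_root_zero_iff[of a c] True by simp
  next
    case False
    then have s: "m1 - m2 > 0" using m(3) by simp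
    have "area u (flow A x t) = 0 \<longleftrightarrow>
      (c + of_real (m1 - m2) * a) * of_real (exp ((m1 - m2) * t)) = c - of_real (m1 - m2) * a" for t
    proof -
      \<comment> \<open>The factor 2 comes from \<open>c + (m1 - m2) * a = 2 * (b - m2 * a)\<close>
        and its counterpart for \<open>m1\<close>, which explain the choice of
        \<open>c\<close>.\<close>
      have "2 * (of_real m1 - of_real m2) * area u (flow A x t)
          = (c + of_real (m1 - m2) * a) * exp (of_real m1 * of_real t)
            - (c - of_real (m1 - m2) * a) * exp (of_real m2 * of_real t)"
      proof -
        have "c + of_real (m1 - m2) * a = 2 * (b - of_real m2 * a)"
          "c - of_real (m1 - m2) * a = 2 * (b - of_real m1 * a)"
          unfolding c_def m(1)[symmetric] by (simp_all add: algebra_simps)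
        then show ?thesis
          using area_flow_distinct[OF root, of u x t]
          unfolding a_def[symmetric] b_def[symmetric] by (simp only: mult.assoc right_diff_distrib[symmetric])
      qed
      also have "exp (of_real m1 * of_real t) = of_real (exp ((m1 - m2) * t)) * exp (of_real m2 * (of_real t :: complex))"
        by (simp add: exp_add[symmetric] algebra_simps flip: exp_of_real)
      finally have "2 * (of_real m1 - of_real m2) * area u (flow A x t)
          = ((c + of_real (m1 - m2) * a) * of_real (exp ((m1 - m2) * t)) - (c - of_real (m1 - m2) * a))
            * exp (of_real m2 * of_real t)"
        by (simp only: left_diff_distrib mult.assoc)
      moreover have "2 * (of_real m1 - of_real m2 :: complex) \<noteq> 0" using False by simp
      ultimately show ?thesis
        by (metis (no_types, lifting) eq_iff_diff_eq_0 exp_not_eq_zero mult_eq_0_iff)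
    qed
    then show ?thesis using two_exponentials_zero_iff[OF s, of c a] by simp
  qed
  have "a = 0 \<and> c = 0 \<longleftrightarrow> a = 0 \<and> b = 0" by (auto simp: c_def)
  then show ?thesis
    unfolding span_singleton_iff_area[OF u] zero crit by simp
qed

text \<open>The roots are conjugate, so the formula for distinct roots presents
  \<open>l - cnj l\<close> times the area as \<open>p * exp (l * t)\<close> minus its conjugate.
  This vanishes whenever the phase \<open>Arg p + Im l * t\<close> is a multiple of pi.\<close>

lemma flow_meets_line_infinitely_often:
  fixes A :: "complex^2^2"
  assumes A: "\<And>i j. A $ i $ j \<in> \<real>" and x: "\<And>i. x $ i \<in> \<real>" and u: "\<And>i. u $ i \<in> \<real>" "u \<noteq> 0"
    and nonreal: "\<And>l. eigenvalue A l \<Longrightarrow> l \<notin> \<real>"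
  shows "infinite {t. t > 0 \<and> flow A x t \<in> vec.span {u}}"
proof -
  obtain z1 z2 where z: "z1 + z2 = A $ 1 $ 1 + A $ 2 $ 2"
      "z1 * z2 = A $ 1 $ 1 * A $ 2 $ 2 - A $ 1 $ 2 * A $ 2 $ 1"
    using characteristic_roots_exist[of A] by blast
  have "Im z1 \<noteq> 0"
    using nonreal characteristic_root_eigenvalue[OF z] by (auto simp: complex_is_Real_iff)
  have "Im (A $ i $ j) = 0" for i j using A by (simp flip: complex_is_Real_iff)
  then have ImT: "Im (z1 + z2) = 0" and ImD: "Im (z1 * z2) = 0"
    unfolding z by simp_all
  have "Im z1 * (Re z2 - Re z1) = 0"
    using ImT ImD by (simp add: algebra_simps eq_neg_iff_add_eq_0[symmetric] flip: minus_mult_right)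
  then have "z2 = cnj z1" using \<open>Im z1 \<noteq> 0\<close> ImT by (simp add: complex_eq_iff)
  \<comment> \<open>Of the two conjugate roots, the one in the upper half plane, so that division by
    \<open>Im l\<close> preserves signs.\<close>
  define l where "l = (if Im z1 > 0 then z1 else cnj z1)"
  have l: "l + cnj l = A $ 1 $ 1 + A $ 2 $ 2" "l * cnj l = A $ 1 $ 1 * A $ 2 $ 2 - A $ 1 $ 2 * A $ 2 $ 1"
    and pos: "Im l > 0"
    using z \<open>Im z1 \<noteq> 0\<close> unfolding \<open>z2 = cnj z1\<close> l_def by (auto simp: add.commute mult.commute)
  define a b where "a = area u x" and "b = area u (A *v x)"
  define p where "p = b - cnj l * a"
  have "a \<in> \<real>" "b \<in> \<real>"
    unfolding a_def b_def area_def matrix_vector_mult_def sum_2 using A x u(1) by (auto simp: sum_2)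
  then have "cnj p = b - l * a" by (simp add: p_def Reals_cnj_iff)
  have zero: "area u (flow A x t) = 0" if "sin (Arg p + Im l * t) = 0" for t
  proof -
    have "p * exp (l * of_real t) = of_real (cmod p * exp (Re l * t)) * cis (Arg p + Im l * t)"
    proof -
      have "p = of_real (cmod p) * cis (Arg p)" by (metis rcis_cmod_Arg rcis_def)
      moreover have "exp (l * of_real t) = of_real (exp (Re l * t)) * cis (Im l * t)"
        by (simp add: exp_eq_polar)
      ultimately show ?thesis by (metis (no_types, lifting) cis_mult mult.assoc mult.left_commute of_real_mult)
    qed
    then have "Im (p * exp (l * of_real t)) = 0" using that by simp
    then have "p * exp (l * of_real t) - cnj (p * exp (l * of_real t)) = 0" by (simp add: complex_eq_iff)
    then have "(l - cnj l) * area u (flow A x t) = 0"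
      unfolding area_flow_distinct[OF l] a_def[symmetric] b_def[symmetric] p_def[symmetric]
        \<open>cnj p = b - l * a\<close>[symmetric] by (simp add: exp_cnj)
    moreover have "l - cnj l \<noteq> 0" using pos by (simp add: complex_eq_iff)
    ultimately show ?thesis by simp
  qed
  \<comment> \<open>Starting at the multiple \<open>N\<close> of pi makes all the times
    positive.\<close>
  obtain N :: nat where N: "real N * pi > Arg p" using reals_Archimedean3[OF pi_gt_zero] by blast
  define t where "t n = (real (N + n) * pi - Arg p) / Im l" for n
  have "t n > 0" for n
  proof -
    have "real N * pi \<le> real (N + n) * pi" by (intro mult_right_mono) auto
    then show ?thesis unfolding t_def using N pos by (intro divide_pos_pos) linarith+
  qed
  moreover have "area u (flow A x (t n)) = 0" for n
  proof (rule zero)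
    have "Arg p + Im l * t n = real (N + n) * pi" using pos by (simp add: t_def)
    then show "sin (Arg p + Im l * t n) = 0" by (simp only: sin_npi)
  qed
  ultimately have "range t \<subseteq> {t. t > 0 \<and> flow A x t \<in> vec.span {u}}"
    using span_singleton_iff_area[OF u(2)] by auto
  moreover have "inj t"
    using pos by (auto simp: inj_on_def t_def)
  ultimately show ?thesis by (meson infinite_iff_countable_subset finite_subset range_inj_infinite)
qed

section \<open>Certified approximations of coded algebraic numbers\<close>

text \<open>Scaled by \<open>b n\<close>, errors stay below 1 while nonzero true values have modulus
  at least 2, so an approximate value tells zero from nonzero. The scale is fixed by
  \<open>n\<close> alone, and \<open>W n\<close> is the precision that it requires.\<close>

lemma polyfun_precision:
  assumes "\<And>f. f \<in> set fs \<Longrightarrow> polyfun f"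
  shows "\<exists>b W. computable b \<and> computable W \<and> (\<forall>n \<rho> q N.
    (\<forall>i<8. poly_bounded n (n * n) (\<rho> i) \<and> cmod (\<rho> i) \<le> real (3 * n)) \<longrightarrow> W n \<le> N \<longrightarrow>
    (\<forall>i<8. cmod (q i - \<rho> i) \<le> 1 / real (Suc N)) \<longrightarrow>
    (\<forall>f\<in>set fs. cmod (f q - f \<rho>) * real (b n) < 1 \<and> (f \<rho> = 0 \<or> 2 \<le> cmod (f \<rho>) * real (b n))))"
proof -
  have "\<forall>f\<in>set fs. \<exists>L. computable L \<and> perturbation_bound L f"
    using assms polyfun_perturbation by blast
  then obtain L where L: "\<And>f. f \<in> set fs \<Longrightarrow> computable (L f)"
    "\<And>f. f \<in> set fs \<Longrightarrow> perturbation_bound (L f) f" by metis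
  have "\<forall>f\<in>set fs. \<exists>B. computable B \<and> (\<forall>n \<rho>. (\<forall>i<8. poly_bounded n (n * n) (\<rho> i)) \<longrightarrow> f \<rho> \<noteq> 0 \<longrightarrow>
    1 \<le> cmod (f \<rho>) * real (B n))"
    using assms polyfun_lower_bound by blast
  then obtain B where B: "\<And>f. f \<in> set fs \<Longrightarrow> computable (B f)"
    "\<And>f n \<rho>. f \<in> set fs \<Longrightarrow> \<forall>i<8. poly_bounded n (n * n) (\<rho> i) \<Longrightarrow> f \<rho> \<noteq> 0 \<Longrightarrow>
    1 \<le> cmod (f \<rho>) * real (B f n)" by metis
  have sum: "computable (\<lambda>n. \<Sum>f\<leftarrow>fs. g f n)" if "\<And>f. f \<in> set fs \<Longrightarrow> computable (g f)" for g
    using that by (induction fs) (auto intro: computable_const computable_add)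
  \<comment> \<open>The sum over the list gives one bound for all functions; the factor 2 leaves
    room for the error.\<close>
  define b where "b n = 2 * (\<Sum>f\<leftarrow>fs. B f n)" for n
  \<comment> \<open>\<open>L\<close> is taken at \<open>3 * n\<close>, the bound for the moduli of
    the coordinates. The error is at most \<open>L f (3 * n) / Suc N\<close>, which
    \<open>N \<ge> W n\<close> makes small enough.\<close>
  define W where "W n = (\<Sum>f\<leftarrow>fs. L f (3 * n)) * b n" for n
  have b: "computable b" unfolding b_def by (intro computable_mult computable_const sum B)
  have W: "computable W" unfolding W_def
    by (intro computable_mult b sum computable_compose[OF L(1)] computable_const computable_id)
  have "cmod (f q - f \<rho>) * real (b n) < 1 \<and> (f \<rho> = 0 \<or> 2 \<le> cmod (f \<rho>) * real (b n))"
    if \<rho>: "\<forall>i<8. poly_bounded n (n * n) (\<rho> i) \<and> cmod (\<rho> i) \<le> real (3 * n)" and N: "W n \<le> N"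
      and q: "\<forall>i<8. cmod (q i - \<rho> i) \<le> 1 / real (Suc N)" and f: "f \<in> set fs" for n \<rho> q N f
  proof
    have "L f (3 * n) \<le> (\<Sum>f\<leftarrow>fs. L f (3 * n))" using f by (intro member_le_sum_list) auto
    then have "L f (3 * n) * b n \<le> N" using N unfolding W_def using le_trans mult_le_mono1 by blast
    then have "real (L f (3 * n)) * real (b n) < real (Suc N)" by (simp flip: of_nat_mult)
    have "cmod (f q - f \<rho>) \<le> real (L f (3 * n)) * (1 / real (Suc N))"
      using \<rho> q by (intro perturbation_boundD(2)[OF L(2)[OF f]]) auto
    then have "cmod (f q - f \<rho>) * real (b n) \<le> real (L f (3 * n)) * (1 / real (Suc N)) * real (b n)"
      by (intro mult_right_mono) auto
    also have "\<dots> = real (L f (3 * n)) * real (b n) / real (Suc N)" by simp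
    also have "\<dots> < 1" using \<open>real (L f (3 * n)) * real (b n) < real (Suc N)\<close> by (simp add: divide_less_eq)
    finally show "cmod (f q - f \<rho>) * real (b n) < 1" .
    have "B f n \<le> (\<Sum>f\<leftarrow>fs. B f n)" using f by (intro member_le_sum_list) auto
    then have "2 * B f n \<le> b n" by (simp add: b_def)
    then have "2 * real (B f n) \<le> real (b n)" by linarith
    then have "cmod (f \<rho>) * (2 * real (B f n)) \<le> cmod (f \<rho>) * real (b n)" by (intro mult_left_mono) auto
    then show "f \<rho> = 0 \<or> 2 \<le> cmod (f \<rho>) * real (b n)" using B(2)[OF f, of n \<rho>] \<rho> by force
  qed
  with b W show ?thesis by blast
qed

text \<open>The summation runs up to the code of the coefficient list, which is at least its length;
  the surplus coefficients decode to 0.\<close>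

definition coded_poly :: "nat \<Rightarrow> complex \<Rightarrow> complex" where
  "coded_poly m z = (\<Sum>j<list_entry m 0. of_int (int_decode (list_entry (list_entry m 0) j)) * z ^ j)"

definition coded_centre :: "nat \<Rightarrow> complex" where
  "coded_centre m = Complex (rat_decode (list_entry m 1)) (rat_decode (list_entry m 2))"

definition coded_radius :: "nat \<Rightarrow> real" where
  "coded_radius m = rat_decode (list_entry m 3)"

lemma alg_codeE:
  assumes "alg_code m z"
  obtains p :: "int poly" where "p \<noteq> 0" "\<And>w. poly (map_poly of_int p) w = coded_poly m w"
    "degree p < list_entry m 0" "\<And>i. \<bar>coeff p i\<bar> \<le> int (list_entry m 0)"
    "\<And>w. coded_poly m w = 0 \<and> cmod (w - coded_centre m) < coded_radius m \<longleftrightarrow> w = z"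
proof -
  obtain cs a b r where m: "m = list_encode [list_encode (map int_encode cs), a, b, r]"
    and p: "Poly cs \<noteq> (0 :: int poly)"
    and z: "{w. poly (map_poly of_int (Poly cs)) w = 0 \<and>
         cmod (w - Complex (rat_decode a) (rat_decode b)) < rat_decode r} = {z}"
    using assms unfolding alg_code_def by blast
  have entries: "list_entry m 0 = list_encode (map int_encode cs)" "list_entry m 1 = a"
    "list_entry m 2 = b" "list_entry m 3 = r"
    unfolding m list_entry_encode by (simp_all add: nth_default_def)
  have coeff: "coeff (Poly cs) i = int_decode (list_entry (list_entry m 0) i)" for i
  proof -
    have "int_decode 0 = 0" by (simp add: int_decode_def sum_decode_def)
    then show ?thesis
      unfolding entries list_entry_encode by (auto simp: nth_default_def)
  qed
  have deg: "degree (Poly cs) < list_entry m 0"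
  proof -
    have "degree (Poly cs) < length cs"
      using p by (metis coeff_Poly_eq leading_coeff_0_iff not_le nth_default_def)
    also have "\<dots> \<le> list_entry m 0" using length_le_list_encode[of "map int_encode cs"] entries by simp
    finally show ?thesis .
  qed
  have poly: "poly (map_poly of_int (Poly cs)) w = coded_poly m w" for w
  proof -
    have "poly (map_poly of_int (Poly cs)) w = (\<Sum>j\<le>degree (Poly cs). of_int (coeff (Poly cs) j) * w ^ j)"
      by (simp add: poly_altdef degree_map_poly coeff_map_poly)
    also have "\<dots> = (\<Sum>j<list_entry m 0. of_int (coeff (Poly cs) j) * w ^ j)"
      using deg by (intro sum.mono_neutral_left) (auto simp: coeff_eq_0 simp del: coeff_Poly_eq)
    finally show ?thesis unfolding coded_poly_def coeff .
  qed
  show thesis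
  proof (rule that[OF p poly deg])
    show "\<bar>coeff (Poly cs) i\<bar> \<le> int (list_entry m 0)" for i
      unfolding coeff using abs_int_decode_le[of "list_entry (list_entry m 0) i"] list_entry_le[of "list_entry m 0" i]
      by linarith
    show "coded_poly m w = 0 \<and> cmod (w - coded_centre m) < coded_radius m \<longleftrightarrow> w = z" for w
      using z unfolding poly coded_centre_def coded_radius_def entries by blast
  qed
qed

text \<open>There are at most \<open>n\<close> coefficients, each of absolute value at most
  \<open>n\<close>.\<close>

lemma alg_code_poly_bounded:
  assumes "alg_code m z" "m \<le> n" shows "poly_bounded n (n * n) z"
proof -
  obtain p :: "int poly" where p: "p \<noteq> 0" "\<And>w. poly (map_poly of_int p) w = coded_poly m w"
    "degree p < list_entry m 0" "\<And>i. \<bar>coeff p i\<bar> \<le> int (list_entry m 0)"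
    "\<And>w. coded_poly m w = 0 \<and> cmod (w - coded_centre m) < coded_radius m \<longleftrightarrow> w = z"
    using alg_codeE[OF assms(1)] by metis
  have e: "list_entry m 0 \<le> n" using list_entry_le assms(2) by (rule order.trans)
  have "(\<Sum>i\<le>degree p. \<bar>coeff p i\<bar>) \<le> (\<Sum>i\<le>degree p. int n)"
    using p(4) e by (intro sum_mono) (meson of_nat_mono order.trans)
  also have "\<dots> = int (Suc (degree p) * n)" by (simp add: algebra_simps)
  also have "\<dots> \<le> int (n * n)" unfolding of_nat_le_iff using p(3) e by (intro mult_le_mono1) simp
  finally show ?thesis unfolding poly_bounded_def
    using p(1,2,3) p(5)[of z] e by (intro exI[of _ p]) auto
qed

text \<open>Each coordinate of the centre contributes at most \<open>n\<close>, and so does the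
  radius.\<close>

lemma alg_code_cmod_le:
  assumes "alg_code m z" "m \<le> n" shows "cmod z \<le> real (3 * n)"
proof -
  have "cmod (z - coded_centre m) < coded_radius m" using alg_codeE[OF assms(1)] by metis
  moreover have "cmod (coded_centre m) \<le> \<bar>rat_decode (list_entry m 1)\<bar> + \<bar>rat_decode (list_entry m 2)\<bar>"
    using cmod_le[of "coded_centre m"] by (simp add: coded_centre_def)
  moreover have "\<bar>rat_decode (list_entry m j)\<bar> \<le> real n" for j
    using abs_rat_decode_le[of "list_entry m j"] list_entry_le[of m j] assms(2) by linarith
  note this[of 1] this[of 2] this[of 3]
  moreover have "cmod z \<le> cmod (z - coded_centre m) + cmod (coded_centre m)"
    using norm_triangle_ineq[of "z - coded_centre m" "coded_centre m"] by simp
  ultimately show ?thesis unfolding coded_radius_def of_nat_mult of_nat_numeral by linarith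
qed

text \<open>A certificate that the rational point \<open>q\<close> has distance at most \<open>1 / Suc N\<close> from the number
  with code \<open>m\<close>: the value of the polynomial is so small that there must be a root that close,
  and this root lies in the isolating disc.\<close>

definition approximates :: "nat \<Rightarrow> complex \<Rightarrow> nat \<Rightarrow> bool" where
  "approximates m q N \<longleftrightarrow>
     (cmod (coded_poly m q))\<^sup>2 * real (Suc N ^ (2 * list_entry m 0)) < 1 \<and>
     1 / real (Suc N) < coded_radius m \<and>
     (cmod (q - coded_centre m))\<^sup>2 < (coded_radius m - 1 / real (Suc N)) * (coded_radius m - 1 / real (Suc N))"

text \<open>The leading coefficient is a nonzero integer, so the value at \<open>q\<close> has at
  least the product of the distances from \<open>q\<close> to the roots as its modulus. If all of
  these exceeded \<open>\<eta> = 1 / Suc N\<close>, it would be at least \<open>\<eta> ^ e\<close>,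
  since the degree is below \<open>e\<close> and \<open>\<eta> \<le> 1\<close>. The margin
  \<open>\<eta>\<close> in the disc condition places the nearby root inside the isolating
  disc.\<close>

lemma approximates_sound:
  assumes z: "alg_code m z" and q: "approximates m q N"
  shows "cmod (q - z) \<le> 1 / real (Suc N)"
proof -
  define \<eta> where "\<eta> = 1 / real (Suc N)"
  have \<eta>: "0 < \<eta>" "\<eta> \<le> 1" by (simp_all add: \<eta>_def)
  define e where "e = list_entry m 0"
  obtain p :: "int poly" where p: "p \<noteq> 0" "\<And>w. poly (map_poly of_int p) w = coded_poly m w"
    "degree p < e"
    "\<And>w. coded_poly m w = 0 \<and> cmod (w - coded_centre m) < coded_radius m \<longleftrightarrow> w = z"
    using alg_codeE[OF z] unfolding e_def by metis
  define P :: "complex poly" where "P = map_poly of_int p"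
  have degP: "degree P = degree p" by (simp add: P_def degree_map_poly)
  have lc: "cmod (lead_coeff P) \<ge> 1"
  proof -
    have "lead_coeff p \<noteq> 0" using p(1) by simp
    then have "\<bar>lead_coeff p\<bar> \<ge> 1" by arith
    then show ?thesis by (simp add: degP) (simp add: P_def coeff_map_poly flip: of_int_abs)
  qed
  obtain root where root: "smult (lead_coeff P) (\<Prod>i<degree P. [:- root i, 1:]) = P"
    using complex_poly_decompose' by metis
  have val: "poly P w = lead_coeff P * (\<Prod>i<degree P. w - root i)" for w
    by (subst root[symmetric]) (simp add: poly_prod)
  have small: "cmod (poly P q) < \<eta> ^ e"
  proof -
    have "(cmod (poly P q) * real (Suc N) ^ e)\<^sup>2 = (cmod (coded_poly m q))\<^sup>2 * real (Suc N ^ (2 * e))"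
      by (simp add: P_def p(2) power_mult_distrib mult.commute del: of_nat_Suc flip: power_mult)
    then have "(cmod (poly P q) * real (Suc N) ^ e)\<^sup>2 < 1\<^sup>2"
      using q by (simp add: approximates_def e_def)
    then have "cmod (poly P q) * real (Suc N) ^ e < 1"
      by (rule power2_less_imp_less) simp
    then show ?thesis by (simp add: \<eta>_def power_one_over pos_less_divide_eq)
  qed
  have "\<exists>i<degree P. cmod (q - root i) \<le> \<eta>"
  proof (rule ccontr)
    assume "\<not> ?thesis"
    then have "\<eta> \<le> cmod (q - root i)" if "i < degree P" for i using that by (meson linear)
    then have "(\<Prod>i<degree P. \<eta>) \<le> (\<Prod>i<degree P. cmod (q - root i))"
      using \<eta> by (intro prod_mono) auto
    also have "\<dots> \<le> cmod (lead_coeff P) * (\<Prod>i<degree P. cmod (q - root i))"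
      using lc mult_right_mono[OF lc, of "\<Prod>i<degree P. cmod (q - root i)"] by (simp add: prod_nonneg)
    also have "\<dots> = cmod (poly P q)" unfolding val norm_mult prod_norm ..
    finally have "\<eta> ^ degree P < \<eta> ^ e" using small by simp
    moreover have "\<eta> ^ e \<le> \<eta> ^ degree P" using \<eta> p(3) degP by (intro power_decreasing) auto
    ultimately show False by simp
  qed
  then obtain i where i: "i < degree P" "cmod (q - root i) \<le> \<eta>" by blast
  have "coded_poly m (root i) = 0"
    using val[of "root i"] i(1) by (auto simp: P_def p(2)[symmetric])
  moreover have "cmod (root i - coded_centre m) < coded_radius m"
  proof -
    have less: "(cmod (q - coded_centre m))\<^sup>2 < (coded_radius m - \<eta>)\<^sup>2" "\<eta> < coded_radius m"
      using q unfolding approximates_def \<eta>_def power2_eq_square by blast+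
    then have "cmod (q - coded_centre m) < coded_radius m - \<eta>"
      using power2_less_imp_less[OF less(1)] by simp
    moreover have "cmod (root i - coded_centre m) \<le> cmod (q - root i) + cmod (q - coded_centre m)"
      using norm_triangle_ineq4[of "q - coded_centre m" "q - root i"] by simp
    ultimately show ?thesis using i(2) by linarith
  qed
  ultimately have "root i = z" using p(4) by blast
  then show ?thesis using i(2) \<eta>_def by simp
qed

text \<open>The certificate is an open condition that holds at \<open>z\<close> itself, and Gaussian
  rationals are dense. The hypothesis on \<open>N\<close> keeps \<open>z\<close> farther than
  \<open>1 / Suc N\<close> from the boundary of the disc.\<close>

lemma approximates_complete:
  assumes z: "alg_code m z" and N: "1 / real (Suc N) < coded_radius m - cmod (z - coded_centre m)"
  shows "\<exists>k. approximates m (gauss_decode k) N"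
proof -
  have z0: "coded_poly m z = 0" using alg_codeE[OF z] by metis
  have r: "1 / real (Suc N) < coded_radius m" using N norm_ge_zero[of "z - coded_centre m"] by linarith
  let ?F = "\<lambda>q. (cmod (coded_poly m q))\<^sup>2 * real (Suc N ^ (2 * list_entry m 0))"
  let ?G = "\<lambda>q. (cmod (q - coded_centre m))\<^sup>2"
  let ?R = "coded_radius m - 1 / real (Suc N)"
  have "isCont ?F z" "isCont ?G z" unfolding coded_poly_def by (intro continuous_intros)+
  moreover have "?F z < 1" by (simp add: z0)
  moreover have "?G z < ?R * ?R"
    using N power_strict_mono[of "cmod (z - coded_centre m)" ?R 2] by (simp add: power2_eq_square)
  ultimately have "\<forall>\<^sub>F q in at z. ?F q < 1 \<and> ?G q < ?R * ?R"
    by (intro eventually_conj order_tendstoD(2)[OF isContD])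
  then obtain d where d: "d > 0" "\<And>q. q \<noteq> z \<Longrightarrow> dist q z < d \<Longrightarrow> ?F q < 1 \<and> ?G q < ?R * ?R"
    unfolding eventually_at by auto
  obtain k where "cmod (gauss_decode k - z) < d" using gauss_decode_approx[OF d(1)] by blast
  \<comment> \<open>The filter \<open>at z\<close> leaves out \<open>z\<close>, which may itself be
    the Gaussian rational found.\<close>
  then have "?F (gauss_decode k) < 1 \<and> ?G (gauss_decode k) < ?R * ?R"
    using d(2)[of "gauss_decode k"] \<open>?F z < 1\<close> \<open>?G z < ?R * ?R\<close>
    by (cases "gauss_decode k = z") (auto simp only: dist_norm)
  then show ?thesis unfolding approximates_def using r by blast
qed

lemma decidable_approximates:
  assumes m: "computable m" and q: "gauss_fun q" and N: "computable N"
  shows "decidable (\<lambda>n. approximates (m n) (q n) (N n))"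
proof -
  have e: "computable (\<lambda>n. list_entry (m n) j)" for j
    by (intro computable_list_entry m computable_const)
  have r: "rational_fun (\<lambda>n. coded_radius (m n))"
    unfolding coded_radius_def by (intro represented_decode e)
  have "gauss_fun (\<lambda>n. coded_centre (m n))"
    unfolding gauss_fun_iff coded_centre_def complex.sel by (intro conjI represented_decode e)
  then have c: "gauss_fun (\<lambda>n. q n - coded_centre (m n))" by (intro gauss_fun_diff q)
  have "gauss_fun (\<lambda>n. coded_poly (m n) (q n))"
    unfolding coded_poly_def
    by (intro gauss_fun_sum gauss_fun_mult gauss_fun_int_decode computable_list_entry computable_const
        gauss_fun_power e represented_compose[OF q] computable_compose[OF m] computable_pi1
        computable_pi2 computable_id)
  then show ?thesis
    unfolding approximates_def
    by (intro decidable_conj decidable_rational_less rational_fun_mult rational_fun_diff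
        rational_fun_cmod_square c r rational_fun_of_nat computable_power computable_Suc
        computable_mult computable_const e N rational_fun_inverse_Suc rational_fun_const[of 1, simplified])
qed

section \<open>The decision procedure\<close>

lemma decidable_cong:
  assumes "decidable P" "\<And>n. P n = Q n" shows "decidable Q"
proof -
  have "P = Q" using assms(2) by (rule ext)
  then show ?thesis using assms(1) by simp
qed

lemma decidable_all_less: "(\<And>i. i < (k :: nat) \<Longrightarrow> decidable (\<lambda>n. P n i)) \<Longrightarrow> decidable (\<lambda>n. \<forall>i<k. P n i)"
proof (induction k)
  case 0
  then show ?case using decidable_const[of True] by simp
next
  case (Suc k)
  then have "decidable (\<lambda>n. P n k \<and> (\<forall>i<k. P n i))" by (intro decidable_conj) auto
  then show ?case by (simp only: All_less_Suc)
qed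

text \<open>The coordinates \<open>0, \<dots>, 3\<close> are the entries of the matrix, \<open>4, 5\<close> those of the initial value and
  \<open>6, 7\<close> those of the vector spanning the line.\<close>

definition trace_fun :: "(nat \<Rightarrow> complex) \<Rightarrow> complex" where
  "trace_fun \<rho> = \<rho> 0 + \<rho> 3"

definition det_fun :: "(nat \<Rightarrow> complex) \<Rightarrow> complex" where
  "det_fun \<rho> = \<rho> 0 * \<rho> 3 - \<rho> 1 * \<rho> 2"

definition value_fun :: "(nat \<Rightarrow> complex) \<Rightarrow> complex" where
  "value_fun \<rho> = \<rho> 6 * \<rho> 5 - \<rho> 7 * \<rho> 4"

definition slope_fun :: "(nat \<Rightarrow> complex) \<Rightarrow> complex" where
  "slope_fun \<rho> = \<rho> 6 * (\<rho> 2 * \<rho> 4 + \<rho> 3 * \<rho> 5) - \<rho> 7 * (\<rho> 0 * \<rho> 4 + \<rho> 1 * \<rho> 5)"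

definition shift_fun :: "(nat \<Rightarrow> complex) \<Rightarrow> complex" where
  "shift_fun \<rho> = slope_fun \<rho> + slope_fun \<rho> - trace_fun \<rho> * value_fun \<rho>"

text \<open>This is \<open>2 * \<i>\<close> times an imaginary part; leaving the factor in place
  avoids a division.\<close>

definition im_fun :: "(nat \<Rightarrow> complex) \<Rightarrow> complex" where
  "im_fun \<rho> = value_fun \<rho> * cnj (shift_fun \<rho>) - cnj (value_fun \<rho> * cnj (shift_fun \<rho>))"

definition re_fun :: "(nat \<Rightarrow> complex) \<Rightarrow> complex" where
  "re_fun \<rho> = value_fun \<rho> * cnj (shift_fun \<rho>) + cnj (value_fun \<rho> * cnj (shift_fun \<rho>))"

definition half_margin_fun :: "(nat \<Rightarrow> complex) \<Rightarrow> complex" where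
  "half_margin_fun \<rho> = shift_fun \<rho> * cnj (shift_fun \<rho>) -
     (trace_fun \<rho> * trace_fun \<rho> - (det_fun \<rho> + det_fun \<rho> + det_fun \<rho> + det_fun \<rho>))
       * (value_fun \<rho> * cnj (value_fun \<rho>))"

text \<open>Like \<open>re_fun\<close>, twice a real part. For a real value the modulus is the
  absolute value of the real part, so that the lower bound on moduli separates the sign from
  zero.\<close>

definition margin_fun :: "(nat \<Rightarrow> complex) \<Rightarrow> complex" where
  "margin_fun \<rho> = half_margin_fun \<rho> + cnj (half_margin_fun \<rho>)"

lemma polyfun_criterion:
  "polyfun value_fun" "polyfun slope_fun" "polyfun im_fun" "polyfun re_fun" "polyfun margin_fun"
proof -
  show v: "polyfun value_fun" and s: "polyfun slope_fun"
    unfolding value_fun_def slope_fun_def by (intro polyfun_diff polyfun.add polyfun.mult polyfun.var; simp)+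
  have t: "polyfun trace_fun" and d: "polyfun det_fun"
    unfolding trace_fun_def det_fun_def by (intro polyfun_diff polyfun.add polyfun.mult polyfun.var; simp)+
  have c: "polyfun shift_fun"
    unfolding shift_fun_def by (intro polyfun_diff polyfun.add polyfun.mult v s t)
  show "polyfun im_fun" "polyfun re_fun" "polyfun margin_fun"
    unfolding im_fun_def re_fun_def margin_fun_def half_margin_fun_def
    by (intro polyfun_diff polyfun.add polyfun.mult polyfun.cnj v s t c d)+
qed

lemma decidable_sign_conditions:
  assumes f: "gauss_fun f" and b: "computable b"
  shows "decidable (\<lambda>n. cmod (f n) * real (b n) < 1)" "decidable (\<lambda>n. Re (f n) * real (b n) < - 1)"
    "decidable (\<lambda>n. 1 < Re (f n) * real (b n))"
proof -
  have 1: "rational_fun (\<lambda>_. 1)" using rational_fun_const[of 1] by simp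
  have "decidable (\<lambda>n. (cmod (f n))\<^sup>2 * (real (b n) * real (b n)) < 1)"
    by (intro decidable_rational_less rational_fun_mult rational_fun_of_nat rational_fun_cmod_square f b 1)
  moreover have "(cmod (f n))\<^sup>2 * (real (b n) * real (b n)) < 1 \<longleftrightarrow> cmod (f n) * real (b n) < 1" for n
  proof -
    have "(cmod (f n))\<^sup>2 * (real (b n) * real (b n)) = (cmod (f n) * real (b n))\<^sup>2"
      by (simp add: power2_eq_square mult_ac)
    also have "\<dots> < 1 \<longleftrightarrow> cmod (f n) * real (b n) < 1"
      by (subst power_less_one_iff) auto
    finally show ?thesis .
  qed
  ultimately show "decidable (\<lambda>n. cmod (f n) * real (b n) < 1)" by (rule decidable_cong)
  have re: "rational_fun (\<lambda>n. Re (f n) * real (b n))"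
    using f unfolding gauss_fun_iff by (intro rational_fun_mult rational_fun_of_nat b) auto
  show "decidable (\<lambda>n. Re (f n) * real (b n) < - 1)" "decidable (\<lambda>n. 1 < Re (f n) * real (b n))"
    by (intro decidable_rational_less re 1 rational_fun_uminus)+
qed

definition coords :: "complex^2^2 \<Rightarrow> complex^2 \<Rightarrow> complex^2 \<Rightarrow> nat \<Rightarrow> complex" where
  "coords A x u i = [A $ 1 $ 1, A $ 1 $ 2, A $ 2 $ 1, A $ 2 $ 2, x $ 1, x $ 2, u $ 1, u $ 2] ! i"

lemma flow_meets_line_iff_coords:
  assumes "\<forall>l. eigenvalue A l \<longrightarrow> l \<in> \<real>" "u \<noteq> 0"
  shows "(\<exists>t>0. flow A x t \<in> vec.span {u}) \<longleftrightarrow>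
    value_fun (coords A x u) = 0 \<and> slope_fun (coords A x u) = 0 \<or>
    im_fun (coords A x u) = 0 \<and> Re (re_fun (coords A x u)) < 0 \<and> 0 < Re (margin_fun (coords A x u))"
proof -
  have v: "value_fun (coords A x u) = area u x" and s: "slope_fun (coords A x u) = area u (A *v x)"
    and t: "trace_fun (coords A x u) = A $ 1 $ 1 + A $ 2 $ 2"
    and d: "det_fun (coords A x u) = A $ 1 $ 1 * A $ 2 $ 2 - A $ 1 $ 2 * A $ 2 $ 1"
    by (simp_all add: coords_def value_fun_def slope_fun_def trace_fun_def det_fun_def area_def
        matrix_vector_mult_def sum_2)
  have im: "z - cnj z = 0 \<longleftrightarrow> Im z = 0" for z by (simp add: complex_eq_iff)
  have re: "Re (z + cnj z) < 0 \<longleftrightarrow> Re z < 0" "0 < Re (z + cnj z) \<longleftrightarrow> 0 < Re z" for z by simp_all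
  have "im_fun (coords A x u) = 0 \<longleftrightarrow> Im (value_fun (coords A x u) * cnj (shift_fun (coords A x u))) = 0"
    unfolding im_fun_def im ..
  moreover have "Re (re_fun (coords A x u)) < 0 \<longleftrightarrow> Re (value_fun (coords A x u) * cnj (shift_fun (coords A x u))) < 0"
    unfolding re_fun_def re ..
  moreover have "0 < Re (margin_fun (coords A x u)) \<longleftrightarrow> 0 < Re (half_margin_fun (coords A x u))"
    unfolding margin_fun_def re ..
  ultimately show ?thesis
    using flow_meets_line_iff[OF assms, of x]
    unfolding half_margin_fun_def shift_fun_def v s t d by (simp only:)
qed

lemma instance_codeE:
  assumes "instance_code n (A, x, U)"
  obtains u where "u \<noteq> 0" "U = vec.span {u}" "\<And>i. i < 8 \<Longrightarrow> alg_code (list_entry n i) (coords A x u i)"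
proof -
  obtain a b c d p q r s u where n: "n = list_encode [a, b, c, d, p, q, r, s]"
    and c: "alg_code a (A $ 1 $ 1)" "alg_code b (A $ 1 $ 2)"
     "alg_code c (A $ 2 $ 1)" "alg_code d (A $ 2 $ 2)"
     "alg_code p (x $ 1)" "alg_code q (x $ 2)" "alg_code r (u $ 1)" "alg_code s (u $ 2)"
    and u: "u \<noteq> 0" "U = vec.span {u}"
    using assms unfolding instance_code_def by blast
  have "alg_code (list_entry n i) (coords A x u i)" if "i < 8" for i
  proof -
    have "i \<in> {0, 1, 2, 3, 4, 5, 6, 7}" using that by auto
    then show ?thesis unfolding n list_entry_encode coords_def
      using c by (auto simp: nth_default_def)
  qed
  with u show thesis by (rule that)
qed

lemma decidable_real_case:
  "decidable_on instance_code
      {(A, x0, U). A \<in> GL2 algebraics \<and> x0 \<in> vectors_over algebraics \<and>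
         U \<in> lines_over algebraics \<and> (\<forall>l. eigenvalue A l \<longrightarrow> l \<in> \<real>)}
      (\<lambda>(A, x0, U). \<exists>t>0. flow A x0 t \<in> U)"
proof -
  have "\<And>f. f \<in> set [value_fun, slope_fun, im_fun, re_fun, margin_fun] \<Longrightarrow> polyfun f"
    using polyfun_criterion by auto
  from polyfun_precision[OF this] obtain b W where b: "computable b" and W: "computable W"
    and prec: "\<And>n \<rho> q N f. \<forall>i<8. poly_bounded n (n * n) (\<rho> i) \<and> cmod (\<rho> i) \<le> real (3 * n) \<Longrightarrow> W n \<le> N \<Longrightarrow>
    \<forall>i<8. cmod (q i - \<rho> i) \<le> 1 / real (Suc N) \<Longrightarrow> f \<in> {value_fun, slope_fun, im_fun, re_fun, margin_fun} \<Longrightarrow>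
    cmod (f q - f \<rho>) * real (b n) < 1 \<and> (f \<rho> = 0 \<or> 2 \<le> cmod (f \<rho>) * real (b n))"
    by (metis (no_types, lifting) list.set)
  define q where "q k i = gauss_decode (list_entry (pi2 k) i)" for k i
  \<comment> \<open>A certificate \<open>k\<close> is a pair of the precision and the code of a list
    of eight Gaussian rationals.\<close>
  define check where "check n k \<longleftrightarrow> W n \<le> pi1 k \<and>
    (\<forall>i<8. approximates (list_entry n i) (q k i) (pi1 k))" for n k
  \<comment> \<open>The thresholds 1 and - 1 lie in the gap between the scaled errors and the scaled
    nonzero values.\<close>
  define ans where "ans n k \<longleftrightarrow>
    cmod (value_fun (q k)) * real (b n) < 1 \<and> cmod (slope_fun (q k)) * real (b n) < 1 \<or>
    cmod (im_fun (q k)) * real (b n) < 1 \<and> Re (re_fun (q k)) * real (b n) < - 1 \<and>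
    1 < Re (margin_fun (q k)) * real (b n)" for n k
  have q: "gauss_fun (\<lambda>p. q (pi2 p) i)" for i
    unfolding q_def by (intro represented_decode computable_list_entry computable_pi2 computable_id computable_const)
  have "decidable (\<lambda>p. check (pi1 p) (pi2 p))"
    unfolding check_def
    by (intro decidable_conj decidable_le computable_compose[OF W] decidable_all_less
        decidable_approximates q computable_list_entry computable_pi1 computable_pi2 computable_id
        computable_const)
  moreover have "decidable (\<lambda>p. ans (pi1 p) (pi2 p))"
  proof -
    have "gauss_fun (\<lambda>p. f (q (pi2 p)))" if "polyfun f" for f
      using that q by (rule polyfun_gauss_fun)
    note sign = decidable_sign_conditions[OF this[OF polyfun_criterion(1)]]
      decidable_sign_conditions[OF this[OF polyfun_criterion(2)]]
      decidable_sign_conditions[OF this[OF polyfun_criterion(3)]]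
      decidable_sign_conditions[OF this[OF polyfun_criterion(4)]]
      decidable_sign_conditions[OF this[OF polyfun_criterion(5)]]
    have "computable (\<lambda>p. b (pi1 p))"
      by (intro computable_compose[OF b] computable_pi1 computable_id)
    then show ?thesis
      unfolding ans_def by (intro decidable_conj decidable_disj sign)
  qed
  ultimately obtain F where F: "\<And>n. (\<exists>k. check n k) \<Longrightarrow>
      \<exists>k. check n k \<and> computes F [n] (if ans n k then 1 else 0)"
    using computes_search[of check ans] by blast
  show ?thesis unfolding decidable_on_def
  proof (intro exI[of _ F] allI impI)
    fix n and X :: "(complex^2^2) \<times> (complex^2) \<times> (complex^2) set"
    assume code: "instance_code n X"
      and X: "X \<in> {(A, x0, U). A \<in> GL2 algebraics \<and> x0 \<in> vectors_over algebraics \<and>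
         U \<in> lines_over algebraics \<and> (\<forall>l. eigenvalue A l \<longrightarrow> l \<in> \<real>)}"
    obtain A x U where AxU: "X = (A, x, U)" by (cases X)
    obtain u where u: "u \<noteq> 0" "U = vec.span {u}"
      and alg: "\<And>i. i < 8 \<Longrightarrow> alg_code (list_entry n i) (coords A x u i)"
      using instance_codeE code unfolding AxU by metis
    let ?\<rho> = "coords A x u"
    have \<rho>: "\<forall>i<8. poly_bounded n (n * n) (?\<rho> i) \<and> cmod (?\<rho> i) \<le> real (3 * n)"
      using alg_code_poly_bounded alg_code_cmod_le alg list_entry_le by blast
    have "\<exists>k. check n k"
    proof -
      define gap where "gap i = coded_radius (list_entry n i) - cmod (?\<rho> i - coded_centre (list_entry n i))" for i
      have "0 < gap i" if "i < 8" for i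
        using alg_codeE[OF alg[OF that]] unfolding gap_def by (metis diff_gt_0_iff_gt)
      \<comment> \<open>Each coordinate lies strictly inside its disc and \<open>1 / Suc N\<close>
        tends to 0, so one large \<open>N\<close> serves all eight.\<close>
      then have "\<forall>i\<in>{..<8}. \<forall>\<^sub>F N in sequentially. 1 / real (Suc N) < gap i"
        using LIMSEQ_Suc[OF lim_1_over_n] by (auto intro: order_tendstoD)
      then have "\<forall>\<^sub>F N in sequentially. \<forall>i\<in>{..<8}. 1 / real (Suc N) < gap i"
        by (simp add: eventually_ball_finite_distrib)
      then obtain N where N: "W n \<le> N" "\<And>i. i < 8 \<Longrightarrow> 1 / real (Suc N) < gap i"
        using eventually_conj[OF eventually_ge_at_top[of "W n"]] eventually_happens'[OF sequentially_bot]
        by (metis (no_types, lifting) lessThan_iff)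
      have "\<exists>k. approximates (list_entry n i) (gauss_decode k) N" if "i < 8" for i
        using approximates_complete[OF alg[OF that]] N(2)[OF that] unfolding gap_def by blast
      then obtain c where c: "\<And>i. i < 8 \<Longrightarrow> approximates (list_entry n i) (gauss_decode (c i)) N" by metis
      have "check n (prod_encode (N, list_encode (map c [0..<8])))"
        unfolding check_def q_def using N(1) c
        by (simp add: list_entry_encode nth_default_def del: upt_Suc)
      then show ?thesis ..
    qed
    from F[OF this] obtain k where k: "check n k" "computes F [n] (if ans n k then 1 else 0)" by blast
    have N: "W n \<le> pi1 k" and qk: "\<forall>i<8. cmod (q k i - ?\<rho> i) \<le> 1 / real (Suc (pi1 k))"
      using k(1) approximates_sound alg unfolding check_def by blast+
    note prec = prec[OF \<rho> N qk]
    \<comment> \<open>A scaled nonzero value of modulus at least 2 cannot be brought below 1 by an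
      error less than 1.\<close>
    have zero: "cmod (f (q k)) * real (b n) < 1 \<longleftrightarrow> f ?\<rho> = 0"
      if "f \<in> {value_fun, slope_fun, im_fun, re_fun, margin_fun}" for f
    proof -
      have "cmod (f ?\<rho>) * real (b n) \<le> (cmod (f (q k)) + cmod (f (q k) - f ?\<rho>)) * real (b n)"
        using norm_triangle_ineq4[of "f (q k)" "f (q k) - f ?\<rho>"] by (intro mult_right_mono) auto
      then show ?thesis using prec[OF that] by (auto simp: distrib_right)
    qed
    have re: "\<bar>Re (f (q k)) * real (b n) - Re (f ?\<rho>) * real (b n)\<bar> < 1"
      if "f \<in> {value_fun, slope_fun, im_fun, re_fun, margin_fun}" for f
    proof -
      have "\<bar>Re (f (q k) - f ?\<rho>)\<bar> * real (b n) \<le> cmod (f (q k) - f ?\<rho>) * real (b n)"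
        by (intro mult_right_mono abs_Re_le_cmod) auto
      also have "\<dots> < 1" using prec[OF that] by blast
      finally show ?thesis by (simp add: left_diff_distrib[symmetric] abs_mult)
    qed
    have re_big: "Re (f ?\<rho>) = 0 \<or> 2 \<le> \<bar>Re (f ?\<rho>)\<bar> * real (b n)"
      if "f \<in> {value_fun, slope_fun, im_fun, re_fun, margin_fun}" "Im (f ?\<rho>) = 0" for f
    proof -
      have "cmod (f ?\<rho>) = \<bar>Re (f ?\<rho>)\<bar>" using that(2) by (simp add: cmod_eq_Re)
      then show ?thesis using prec[OF that(1)] by auto
    qed
    have neg: "Re (f (q k)) * real (b n) < - 1 \<longleftrightarrow> Re (f ?\<rho>) < 0"
      and pos: "1 < Re (f (q k)) * real (b n) \<longleftrightarrow> 0 < Re (f ?\<rho>)"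
      if f: "f \<in> {value_fun, slope_fun, im_fun, re_fun, margin_fun}" "Im (f ?\<rho>) = 0" for f
    proof -
      consider "Re (f ?\<rho>) = 0" | "Re (f ?\<rho>) < 0" "Re (f ?\<rho>) * real (b n) \<le> - 2"
        | "Re (f ?\<rho>) > 0" "2 \<le> Re (f ?\<rho>) * real (b n)"
        using re_big[OF f] by (cases "Re (f ?\<rho>)" "0 :: real" rule: linorder_cases) auto
      then show "Re (f (q k)) * real (b n) < - 1 \<longleftrightarrow> Re (f ?\<rho>) < 0"
        "1 < Re (f (q k)) * real (b n) \<longleftrightarrow> 0 < Re (f ?\<rho>)"
        using re[OF f(1)] by (cases; auto simp: abs_less_iff)+
    qed
    have real: "\<forall>l. eigenvalue A l \<longrightarrow> l \<in> \<real>" using X unfolding AxU by blast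
    \<comment> \<open>Realness by construction is what the sign tests \<open>neg\<close> and
      \<open>pos\<close> require.\<close>
    have "Im (re_fun ?\<rho>) = 0" by (simp add: re_fun_def)
    moreover have "Im (margin_fun ?\<rho>) = 0" by (simp add: margin_fun_def)
    ultimately have "ans n k \<longleftrightarrow> (\<exists>t>0. flow A x t \<in> U)"
      unfolding ans_def u(2) flow_meets_line_iff_coords[OF real u(1)]
      by (simp only: zero neg pos insert_iff simp_thms)
    then show "computes F [n] (if case X of (A, x0, U) \<Rightarrow> \<exists>t>0. flow A x0 t \<in> U then 1 else 0)"
      using k(2) unfolding AxU prod.case by simp
  qed
qed

theorem theorem1p4:
  shows "decidable_on instance_code
      {(A, x0, U). A \<in> GL2 algebraics \<and> x0 \<in> vectors_over algebraics \<and>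
         U \<in> lines_over algebraics \<and> (\<forall>l. eigenvalue A l \<longrightarrow> l \<in> \<real>)}
      (\<lambda>(A, x0, U). \<exists>t>0. flow A x0 t \<in> U)
    \<and> (\<forall>A \<in> GL2 (algebraics \<inter> \<real>). \<forall>x0 \<in> vectors_over (algebraics \<inter> \<real>).
        \<forall>U \<in> lines_over (algebraics \<inter> \<real>).
        (\<forall>l. eigenvalue A l \<longrightarrow> l \<notin> \<real>) \<longrightarrow> infinite {t. t > 0 \<and> flow A x0 t \<in> U})"
proof (intro conjI ballI impI)
  fix A x0 U
  assume A: "A \<in> GL2 (algebraics \<inter> \<real>)" and x0: "x0 \<in> vectors_over (algebraics \<inter> \<real>)"
    and U: "U \<in> lines_over (algebraics \<inter> \<real>)" and nonreal: "\<forall>l. eigenvalue A l \<longrightarrow> l \<notin> \<real>"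
  obtain u where u: "u \<in> vectors_over (algebraics \<inter> \<real>)" "u \<noteq> 0" "U = vec.span {u}"
    using U by (auto simp: lines_over_def)
  show "infinite {t. t > 0 \<and> flow A x0 t \<in> U}"
    unfolding u(3)
    by (rule flow_meets_line_infinitely_often)
      (use A x0 u(1,2) nonreal in \<open>auto simp: GL2_def vectors_over_def\<close>)
qed (rule decidable_real_case)

end
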